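(* Let $n\ge4$ and consider the degree-$4$ set function $f:2^{\{1,\dots,n\}}\to\mathbb{R}$ whose multilinear extension $F$ is, for $n$ odd, $$F(x)=\Big(-2\sum_{1\le i<j\le n-2}x_ix_j-\frac{n^2-4n+3}{4}\Big)x_{n-1}x_n+(n-3)\sum_{i=1}^{n-2}x_i\cdot(x_{n-1}x_n-x_{n-1}-x_n),$$ and, for $n$ even, $$F(x)=\Big(-2\sum_{1\le i<j\le n-2}x_ix_j-\frac{(n-2)(n-4)}{4}\Big)x_{n-1}x_n+(n-4)\sum_{i=1}^{n-2}x_i\cdot(x_{n-1}x_n-x_{n-1}-x_n).$$ Then $f$ is submodular (in fact, $\lceil\frac{n-2}{2}\rceil$-sos-submodular when $n$ is odd and $\lceil\frac{n-1}{2}\rceil$-sos-submodular when $n$ is even), but $f$ is not $t$-sos-submodular for any $t\in\mathbb{N}$ with $t\le\lceil\frac{n-2}{2}\rceil-1$.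
   Context: $\mathbb{N}$ includes $0$. A set function $f:2^\Omega\to\mathbb{R}$, $\Omega=\{1,\dots,n\}$, is submodular if $f(S)+f(T)\ge f(S\cup T)+f(S\cap T)$ for all $S,T\subseteq\Omega$. The multilinear extension (MLE) of $f$ is the unique multilinear polynomial $F\in\mathbb{R}[x_1,\dots,x_n]$ (every variable appears with power at most $1$ in every monomial) with $F(1_S)=f(S)$ for all $S\subseteq\Omega$, where $1_S\in\{0,1\}^n$ is the indicator vector of $S$. The degree of $f$ is the degree of $F$. For an ideal $I$ of a real polynomial ring, a polynomial $p$ is $t$-sos modulo $I$ if there are finitely many polynomials $q_1,\dots,q_m$ in that ring, each of degree at most $t$, with $p-\sum_{r=1}^m q_r^2\in I$. For $i\ne j$, $x_{-i,j}$ denotes the variables $x_1,\dots,x_n$ with $x_i,x_j$ removed, and $I_2[x_{-i,j}]=\langle x_k^2-x_k : k\neq i,j\rangle\subseteq\mathbb{R}[x_{-i,j}]$. The set function $f$ with MLE $F$ is $t$-sos-submodular if for all $i\neq j$ the polynomial $-\frac{\partial^2F(x)}{\partial x_i\partial x_j}$ (which does not involve $x_i,x_j$) is $t$-sos modulo $I_2[x_{-i,j}]$. *)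

theory Defs
  imports Complex_Main "HOL-Library.Poly_Mapping" "HOL-Library.Indicator_Function"
begin

text \<open>Real polynomials in the variables $x_0, x_1, x_2, \dots$: a monomial is the finitely
  supported map from variable indices to exponents. The ring $\mathbb{R}[x_k : k \in V]$ is the
  subset \<open>poly_ring V\<close>.\<close>

type_synonym monom = "nat \<Rightarrow>\<^sub>0 nat"
type_synonym mpoly = "monom \<Rightarrow>\<^sub>0 real"

definition Const :: "real \<Rightarrow> mpoly" where
  "Const c = Poly_Mapping.single 0 c"

definition X :: "nat \<Rightarrow> mpoly" where
  "X i = Poly_Mapping.single (Poly_Mapping.single i 1) 1"

definition poly_ring :: "nat set \<Rightarrow> mpoly set" where
  "poly_ring V = {p. \<forall>m\<in>Poly_Mapping.keys p. Poly_Mapping.keys m \<subseteq> V}"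

definition monom_degree :: "monom \<Rightarrow> nat" where
  "monom_degree m = (\<Sum>k\<in>Poly_Mapping.keys m. Poly_Mapping.lookup m k)"

text \<open>Total degree, with the convention that the zero polynomial has degree 0.\<close>

definition total_degree :: "mpoly \<Rightarrow> nat" where
  "total_degree p = Max (insert 0 (monom_degree ` Poly_Mapping.keys p))"

definition eval_poly :: "(nat \<Rightarrow> real) \<Rightarrow> mpoly \<Rightarrow> real" where
  "eval_poly a p = (\<Sum>m\<in>Poly_Mapping.keys p.
     Poly_Mapping.lookup p m * (\<Prod>k\<in>Poly_Mapping.keys m. a k ^ Poly_Mapping.lookup m k))"

text \<open>Formal partial derivative. The truncated subtraction of exponents is harmless: a monomial
  not containing $x_i$ gets the coefficient 0.\<close>

definition partial_deriv :: "nat \<Rightarrow> mpoly \<Rightarrow> mpoly" where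
  "partial_deriv i p = (\<Sum>m\<in>Poly_Mapping.keys p.
     Poly_Mapping.single (m - Poly_Mapping.single i 1)
       (real (Poly_Mapping.lookup m i) * Poly_Mapping.lookup p m))"

definition multilinear :: "mpoly \<Rightarrow> bool" where
  "multilinear p \<longleftrightarrow> (\<forall>m\<in>Poly_Mapping.keys p. \<forall>k. Poly_Mapping.lookup m k \<le> 1)"

text \<open>The ideal of \<open>poly_ring V\<close> generated by a set \<open>G\<close> of its elements.\<close>

definition gen_ideal :: "nat set \<Rightarrow> mpoly set \<Rightarrow> mpoly set" where
  "gen_ideal V G = {\<Sum>g\<in>A. c g * g | A c. finite A \<and> A \<subseteq> G \<and> (\<forall>g\<in>A. c g \<in> poly_ring V)}"

definition I2 :: "nat set \<Rightarrow> mpoly set" where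
  "I2 V = gen_ideal V {X k ^ 2 - X k | k. k \<in> V}"

definition sos_mod :: "nat set \<Rightarrow> mpoly set \<Rightarrow> nat \<Rightarrow> mpoly \<Rightarrow> bool" where
  "sos_mod V I t p \<longleftrightarrow> (\<exists>(m::nat) q.
     (\<forall>r\<in>{1..m}. q r \<in> poly_ring V \<and> total_degree (q r) \<le> t) \<and>
     p - (\<Sum>r = 1..m. q r ^ 2) \<in> I)"

text \<open>Set functions on $\{1, \dots, n\}$ are functions \<open>nat set \<Rightarrow> real\<close>, of which only the
  values on the subsets of \<open>{1..n}\<close> matter.\<close>

definition submodular :: "nat \<Rightarrow> (nat set \<Rightarrow> real) \<Rightarrow> bool" where
  "submodular n f \<longleftrightarrow>
     (\<forall>S T. S \<subseteq> {1..n} \<longrightarrow> T \<subseteq> {1..n} \<longrightarrow> f S + f T \<ge> f (S \<union> T) + f (S \<inter> T))"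

definition is_mle :: "nat \<Rightarrow> (nat set \<Rightarrow> real) \<Rightarrow> mpoly \<Rightarrow> bool" where
  "is_mle n f F \<longleftrightarrow> F \<in> poly_ring {1..n} \<and> multilinear F \<and>
     (\<forall>S. S \<subseteq> {1..n} \<longrightarrow> eval_poly (indicator S) F = f S)"

definition mle :: "nat \<Rightarrow> (nat set \<Rightarrow> real) \<Rightarrow> mpoly" where
  "mle n f = (THE F. is_mle n f F)"

definition setfun_degree :: "nat \<Rightarrow> (nat set \<Rightarrow> real) \<Rightarrow> nat" where
  "setfun_degree n f = total_degree (mle n f)"

definition sos_submodular :: "nat \<Rightarrow> nat \<Rightarrow> (nat set \<Rightarrow> real) \<Rightarrow> bool" where
  "sos_submodular n t f \<longleftrightarrow> (\<forall>i\<in>{1..n}. \<forall>j\<in>{1..n}. i \<noteq> j \<longrightarrow>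
     sos_mod ({1..n} - {i, j}) (I2 ({1..n} - {i, j})) t
       (- partial_deriv i (partial_deriv j (mle n f))))"

definition F_odd :: "nat \<Rightarrow> mpoly" where
  "F_odd n =
     (- Const 2 * (\<Sum>(i, j)\<in>{(i, j). 1 \<le> i \<and> i < j \<and> j \<le> n - 2}. X i * X j)
       - Const ((real n ^ 2 - 4 * real n + 3) / 4)) * X (n - 1) * X n
     + Const (real n - 3) * (\<Sum>i = 1..n - 2. X i) * (X (n - 1) * X n - X (n - 1) - X n)"

definition F_even :: "nat \<Rightarrow> mpoly" where
  "F_even n =
     (- Const 2 * (\<Sum>(i, j)\<in>{(i, j). 1 \<le> i \<and> i < j \<and> j \<le> n - 2}. X i * X j)
       - Const ((real n - 2) * (real n - 4) / 4)) * X (n - 1) * X n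
     + Const (real n - 4) * (\<Sum>i = 1..n - 2. X i) * (X (n - 1) * X n - X (n - 1) - X n)"

text \<open>Existence and uniqueness of the multilinear extension.\<close>

definition sqfree_monom :: "nat set \<Rightarrow> monom" where
  "sqfree_monom S = (\<Sum>i\<in>S. Poly_Mapping.single i 1)"

lemma lookup_sqfree_monom:
  assumes "finite S"
  shows "Poly_Mapping.lookup (sqfree_monom S) k = of_bool (k \<in> S)"
  using assms
  by (simp add: sqfree_monom_def lookup_sum lookup_single when_def sum.delta')

lemma keys_sqfree_monom:
  assumes "finite S"
  shows "Poly_Mapping.keys (sqfree_monom S) = S"
  by (auto simp: in_keys_iff lookup_sqfree_monom[OF assms])

lemma sqfree_monom_keys:
  assumes "\<And>k. Poly_Mapping.lookup m k \<le> 1"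
  shows "sqfree_monom (Poly_Mapping.keys m) = m"
proof (rule poly_mapping_eqI)
  fix k
  show "Poly_Mapping.lookup (sqfree_monom (Poly_Mapping.keys m)) k = Poly_Mapping.lookup m k"
    using assms[of k] by (auto simp: lookup_sqfree_monom in_keys_iff)
qed

lemma eval_poly_indicator:
  assumes "multilinear p" "finite S"
  shows "eval_poly (indicator S) p = (\<Sum>T\<in>Pow S. Poly_Mapping.lookup p (sqfree_monom T))"
proof -
  have pr: "(\<Prod>k\<in>Poly_Mapping.keys m. indicator S k ^ Poly_Mapping.lookup m k) =
      (of_bool (Poly_Mapping.keys m \<subseteq> S) :: real)" for m :: monom
  proof (cases "Poly_Mapping.keys m \<subseteq> S")
    case True
    then show ?thesis by (auto simp: indicator_def intro!: prod.neutral)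
  next
    case False
    then obtain k where "k \<in> Poly_Mapping.keys m" "k \<notin> S" by auto
    then have "\<exists>k\<in>Poly_Mapping.keys m. (indicator S k :: real) ^ Poly_Mapping.lookup m k = 0"
      by (auto simp: in_keys_iff intro!: bexI[of _ k])
    then show ?thesis using False by (simp add: prod_zero)
  qed
  have inj: "inj_on sqfree_monom (Pow S)"
    by (metis (no_types, lifting) PowD assms(2) finite_subset inj_onI keys_sqfree_monom)
  have "eval_poly (indicator S) p =
      (\<Sum>m\<in>Poly_Mapping.keys p. if Poly_Mapping.keys m \<subseteq> S then Poly_Mapping.lookup p m else 0)"
    unfolding eval_poly_def pr by (rule sum.cong) auto
  also have "\<dots> = (\<Sum>m\<in>{m\<in>Poly_Mapping.keys p. Poly_Mapping.keys m \<subseteq> S}. Poly_Mapping.lookup p m)"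
    by (simp add: sum.inter_filter)
  also have "\<dots> = (\<Sum>m\<in>sqfree_monom ` Pow S. Poly_Mapping.lookup p m)"
  proof (rule sum.mono_neutral_left)
    show "finite (sqfree_monom ` Pow S)" using assms by simp
    show "{m\<in>Poly_Mapping.keys p. Poly_Mapping.keys m \<subseteq> S} \<subseteq> sqfree_monom ` Pow S"
    proof
      fix m assume m: "m \<in> {m\<in>Poly_Mapping.keys p. Poly_Mapping.keys m \<subseteq> S}"
      then have "sqfree_monom (Poly_Mapping.keys m) = m"
        using assms(1) by (intro sqfree_monom_keys) (auto simp: multilinear_def)
      then show "m \<in> sqfree_monom ` Pow S" using m by (metis (no_types, lifting) PowI image_eqI mem_Collect_eq)
    qed
    show "\<forall>m\<in>sqfree_monom ` Pow S - {m\<in>Poly_Mapping.keys p. Poly_Mapping.keys m \<subseteq> S}.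
        Poly_Mapping.lookup p m = 0"
      using assms(2) by (auto simp: in_keys_iff keys_sqfree_monom finite_subset)
  qed
  also have "\<dots> = (\<Sum>T\<in>Pow S. Poly_Mapping.lookup p (sqfree_monom T))"
    by (simp add: sum.reindex[OF inj])
  finally show ?thesis .
qed

lemma is_mle_unique:
  assumes F: "is_mle n f F" and G: "is_mle n f G"
  shows "F = G"
proof -
  have eq: "Poly_Mapping.lookup F (sqfree_monom T) = Poly_Mapping.lookup G (sqfree_monom T)"
    if "finite T" "T \<subseteq> {1..n}" for T
    using that
  proof (induction T rule: finite_psubset_induct)
    case (psubset T)
    have split: "(\<Sum>U\<in>Pow T. h U) = h T + (\<Sum>U\<in>Pow T - {T}. h U)" for h :: "nat set \<Rightarrow> real"
      using psubset.hyps by (simp add: sum.remove[of "Pow T" T])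
    have "(\<Sum>U\<in>Pow T. Poly_Mapping.lookup F (sqfree_monom U)) =
        (\<Sum>U\<in>Pow T. Poly_Mapping.lookup G (sqfree_monom U))"
      using F G psubset by (simp add: is_mle_def flip: eval_poly_indicator)
    moreover have "(\<Sum>U\<in>Pow T - {T}. Poly_Mapping.lookup F (sqfree_monom U)) =
        (\<Sum>U\<in>Pow T - {T}. Poly_Mapping.lookup G (sqfree_monom U))"
      using psubset by (intro sum.cong) auto
    ultimately show ?case unfolding split by simp
  qed
  show ?thesis
  proof (rule poly_mapping_eqI)
    fix m
    have "Poly_Mapping.lookup F m = Poly_Mapping.lookup G m"
      if "m \<in> Poly_Mapping.keys F \<union> Poly_Mapping.keys G"
    proof -
      have "Poly_Mapping.keys m \<subseteq> {1..n}" "\<And>k. Poly_Mapping.lookup m k \<le> 1"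
        using that F G by (auto simp: is_mle_def poly_ring_def multilinear_def)
      then show ?thesis using eq[of "Poly_Mapping.keys m"] by (simp add: sqfree_monom_keys)
    qed
    then show "Poly_Mapping.lookup F m = Poly_Mapping.lookup G m"
      by (cases "m \<in> Poly_Mapping.keys F \<union> Poly_Mapping.keys G") (auto simp: in_keys_iff)
  qed
qed

lemma is_mle_exists: "\<exists>F. is_mle n f F"
proof -
  define a where "a = (\<lambda>T. (-1) ^ card T * (\<Sum>U\<in>Pow T. (-1) ^ card U * f U))"
  define F :: mpoly where "F = (\<Sum>S\<in>Pow {1..n}. Poly_Mapping.single (sqfree_monom S) (a S))"
  have keysF: "\<exists>S. S \<subseteq> {1..n} \<and> m = sqfree_monom S" if "m \<in> Poly_Mapping.keys F" for m
  proof -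
    have "Poly_Mapping.keys F \<subseteq>
        (\<Union>S\<in>Pow {1..n}. Poly_Mapping.keys (Poly_Mapping.single (sqfree_monom S) (a S)))"
      unfolding F_def by (rule keys_sum)
    with that show ?thesis by (auto split: if_splits)
  qed
  have ml: "multilinear F"
    unfolding multilinear_def
    by (metis finite_atLeastAtMost finite_subset keysF le_numeral_extra(4) lookup_sqfree_monom
        of_bool_eq(1,2) zero_le_one)
  have ring: "F \<in> poly_ring {1..n}"
  proof -
    have "Poly_Mapping.keys m \<subseteq> {1..n}" if "m \<in> Poly_Mapping.keys F" for m
    proof -
      obtain S where S: "S \<subseteq> {1..n}" "m = sqfree_monom S" using keysF \<open>m \<in> _\<close> by blast
      moreover have "finite S" using S finite_subset by blast
      ultimately show ?thesis by (simp add: keys_sqfree_monom)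
    qed
    then show ?thesis by (simp add: poly_ring_def)
  qed
  have lk: "Poly_Mapping.lookup F (sqfree_monom T) = a T" if "T \<subseteq> {1..n}" for T
  proof -
    have "Poly_Mapping.lookup F (sqfree_monom T) =
        (\<Sum>S\<in>Pow {1..n}. if S = T then a S else 0)"
      unfolding F_def lookup_sum
    proof (rule sum.cong[OF refl])
      fix S assume "S \<in> Pow {1..n}"
      then have "finite S" "finite T" using that by (auto intro: finite_subset)
      then have "sqfree_monom S = sqfree_monom T \<longleftrightarrow> S = T" by (metis keys_sqfree_monom)
      then show "Poly_Mapping.lookup (Poly_Mapping.single (sqfree_monom S) (a S)) (sqfree_monom T) =
          (if S = T then a S else 0)"
        by (simp add: lookup_single when_def)
    qed
    also have "\<dots> = a T" using that by simp
    finally show ?thesis .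
  qed
  have "eval_poly (indicator S) F = f S" if S: "S \<subseteq> {1..n}" for S
  proof -
    have fin: "finite S" using S finite_subset by blast
    have "eval_poly (indicator S) F = (\<Sum>T\<in>Pow S. a T)"
      unfolding eval_poly_indicator[OF ml fin] using S by (intro sum.cong) (auto simp: lk)
    also have "\<dots> = f S"
      unfolding a_def by (rule inclusion_exclusion_symmetric[OF refl fin, symmetric])
    finally show ?thesis .
  qed
  with ml ring show ?thesis unfolding is_mle_def by blast
qed

lemma is_mle_mle: "is_mle n f (mle n f)"
  unfolding mle_def by (rule theI') (metis is_mle_exists is_mle_unique)

lemma mle_eq_iff: "mle n f = F \<longleftrightarrow> is_mle n f F"
  by (metis is_mle_mle is_mle_unique)

text \<open>\<open>F_odd n\<close> and \<open>F_even n\<close> are the multilinear extensions of their restrictions to the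
  vertices of the cube.\<close>

definition ml_ring :: "nat set \<Rightarrow> mpoly set" where
  "ml_ring V = {p \<in> poly_ring V. multilinear p}"

lemma ml_ring_iff: "p \<in> ml_ring V \<longleftrightarrow>
    (\<forall>m\<in>Poly_Mapping.keys p. Poly_Mapping.keys m \<subseteq> V \<and> (\<forall>k. Poly_Mapping.lookup m k \<le> 1))"
  by (auto simp: ml_ring_def poly_ring_def multilinear_def)

lemma ml_ring_Const: "Const c \<in> ml_ring V"
  by (simp add: ml_ring_iff Const_def)

lemma ml_ring_X: "i \<in> V \<Longrightarrow> X i \<in> ml_ring V"
  by (auto simp: ml_ring_iff X_def lookup_single when_def)

lemma ml_ring_add: "p \<in> ml_ring V \<Longrightarrow> q \<in> ml_ring V \<Longrightarrow> p + q \<in> ml_ring V"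
  using keys_add[of p q] by (fastforce simp: ml_ring_iff)

lemma ml_ring_minus: "p \<in> ml_ring V \<Longrightarrow> - p \<in> ml_ring V"
  by (simp add: ml_ring_iff)

lemma ml_ring_diff: "p \<in> ml_ring V \<Longrightarrow> q \<in> ml_ring V \<Longrightarrow> p - q \<in> ml_ring V"
  using ml_ring_add[of p V "- q"] ml_ring_minus[of q V] by simp

lemma ml_ring_sum: "(\<And>i. i \<in> I \<Longrightarrow> p i \<in> ml_ring V) \<Longrightarrow> sum p I \<in> ml_ring V"
proof (induction I rule: infinite_finite_induct)
  case (insert i I)
  then show ?case by (simp add: ml_ring_add)
qed (simp_all add: ml_ring_iff)

lemma ml_ring_mult:
  assumes "p \<in> ml_ring V" "q \<in> ml_ring W" "V \<inter> W = {}" "V \<union> W \<subseteq> U"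
  shows "p * q \<in> ml_ring U"
  unfolding ml_ring_iff
proof
  fix m assume "m \<in> Poly_Mapping.keys (p * q)"
  then obtain a b where ab: "m = a + b" "a \<in> Poly_Mapping.keys p" "b \<in> Poly_Mapping.keys q"
    using keys_mult[of p q] by blast
  have a: "Poly_Mapping.keys a \<subseteq> V" "\<And>k. Poly_Mapping.lookup a k \<le> 1"
    and b: "Poly_Mapping.keys b \<subseteq> W" "\<And>k. Poly_Mapping.lookup b k \<le> 1"
    using assms(1,2) ab by (auto simp: ml_ring_iff)
  have "Poly_Mapping.lookup m k \<le> 1" for k
  proof (cases "k \<in> V")
    case True
    then have "k \<notin> Poly_Mapping.keys b" using b(1) assms(3) by blast
    then show ?thesis using a(2)[of k] by (simp add: ab(1) lookup_add in_keys_iff)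
  next
    case False
    then have "k \<notin> Poly_Mapping.keys a" using a(1) by blast
    then show ?thesis using b(2)[of k] by (simp add: ab(1) lookup_add in_keys_iff)
  qed
  moreover have "Poly_Mapping.keys m \<subseteq> U"
    using keys_add[of a b] a(1) b(1) assms(4) ab(1) by blast
  ultimately show "Poly_Mapping.keys m \<subseteq> U \<and> (\<forall>k. Poly_Mapping.lookup m k \<le> 1)" by blast
qed

lemma ml_ring_F_shape:
  assumes "n \<ge> 4"
  shows "(- Const 2 * (\<Sum>(i, j)\<in>{(i, j). 1 \<le> i \<and> i < j \<and> j \<le> n - 2}. X i * X j) - Const c)
      * X (n - 1) * X n
    + Const d * (\<Sum>i = 1..n - 2. X i) * (X (n - 1) * X n - X (n - 1) - X n) \<in> ml_ring {1..n}"
proof -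
  have *: "(\<Sum>(i, j)\<in>{(i, j). 1 \<le> i \<and> i < j \<and> j \<le> n - 2}. X i * X j) \<in> ml_ring {1..n-2}"
  proof (rule ml_ring_sum, clarify)
    fix i j :: nat assume "1 \<le> i" "i < j" "j \<le> n - 2"
    then show "X i * X j \<in> ml_ring {1..n-2}"
      by (intro ml_ring_mult[of _ "{i}" _ "{j}"] ml_ring_X) auto
  qed
  have "- Const 2 * (\<Sum>(i, j)\<in>{(i, j). 1 \<le> i \<and> i < j \<and> j \<le> n - 2}. X i * X j) - Const c
      \<in> ml_ring {1..n-2}" (is "?A \<in> _")
    using * by (intro ml_ring_diff ml_ring_Const ml_ring_mult[of _ "{}" _ "{1..n-2}"] ml_ring_minus) auto
  then have A: "?A * X (n - 1) * X n \<in> ml_ring {1..n}"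
    using assms
    by (intro ml_ring_mult[of _ "{1..n-1}" _ "{n}"] ml_ring_mult[of _ "{1..n-2}" _ "{n-1}"] ml_ring_X) auto
  have B: "Const d * (\<Sum>i = 1..n - 2. X i) \<in> ml_ring {1..n-2}"
    by (intro ml_ring_mult[of _ "{}" _ "{1..n-2}"] ml_ring_Const ml_ring_sum ml_ring_X) auto
  have C: "X (n - 1) * X n - X (n - 1) - X n \<in> ml_ring {n-1,n}"
    using assms by (intro ml_ring_diff ml_ring_mult[of _ "{n-1}" _ "{n}"] ml_ring_X) auto
  show ?thesis
    using assms by (intro ml_ring_add A ml_ring_mult[OF B C]) auto
qed

lemma mle_F_odd: "n \<ge> 4 \<Longrightarrow> mle n (\<lambda>S. eval_poly (indicator S) (F_odd n)) = F_odd n"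
  unfolding mle_eq_iff is_mle_def F_odd_def
  using ml_ring_F_shape by (simp add: ml_ring_def)

lemma mle_F_even: "n \<ge> 4 \<Longrightarrow> mle n (\<lambda>S. eval_poly (indicator S) (F_even n)) = F_even n"
  unfolding mle_eq_iff is_mle_def F_even_def
  using ml_ring_F_shape by (simp add: ml_ring_def)

end

theory Submission
  imports Defs "HOL-Combinatorics.Transposition"
begin

text \<open>Write $N = n - 2$, let $s$ be the sum of the first $N$ variables, and let $k$ be the number with
$n = 2k+3$ or $n = 2k+4$. On the cube, the negated second derivatives of $F$ are $2 x_{n-1} x_n$,
expressions $2 z s' + 2k(1-z)$ with $z$ one of the last two variables and $s'$ the sum of the
other undifferentiated variables, and, for the pair $(n-1, n)$, the product $p = (s-k)(s-k-1)$ of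
two consecutive integers. The first two kinds are visibly sums of squares of polynomials of degree
at most 2, so everything is decided by $p$. A
polynomial of the ring lies in the ideal of the cube if and only if it vanishes at all vertices
(\<open>in_I2_if_vanishing_on_cube\<close>), so congruences may be checked pointwise; and
nonnegativity of all negated second differences gives submodularity
(\<open>sos_submodular_imp_submodular\<close>).

Upper bound (\<open>consecutive_product_sos\<close>). For $2k+1$ variables one writes
$p = p^2 \cdot (1/p)$ and expands $1/p$ by Newton interpolation at the values of $s$ other than
$k, k+1$, taken in the symmetric pairs $\{i, 2k+1-i\}$. The Newton basis consists of the products
$\prod_{i<j} (s-i)(2k+1-s-i)$, all coefficients are positive, and each basis element is a sum of
squares of degree $j$, because it is a symmetrisation of $(x_1-x_2)^2 (x_3-x_4)^2 \cdots$. Since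
$j < k$, the total degree is at most $2 + (k-1)$. For even $n$ there are $2k+2$ variables; adding
one variable that is constantly 1 turns this into the odd case for $k+1$.

Lower bound (\<open>consecutive_product_not_sos\<close>). For $k \ge 1$ a linear functional is
defined on monomials as if $2k+1$ of the variables were exchangeable and had the impossible sum
$k + 1/2$. It annihilates the ideal of the cube and gives $p$ the value $-1/4$, so it suffices that
it is nonnegative on squares of polynomials of degree at most $k$ (\<open>moment_form_nonneg\<close>).
This goes by induction on $k$. On a polynomial that changes sign under the exchange of two variables,
that is, $(x_a - x_b) g$, the form is a positive multiple of the form for $k-1$ at $g$. Hence
removing such antisymmetric parts can only decrease the form, and one may symmetrise completely;
for a symmetric polynomial the form is the square of its value at $s = k + 1/2$. The remaining
case $k = 0$, $n = 4$ concerns sums of squares of constants, while $p = 2 x_1 x_2$ is not constant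
on the cube.\<close>

section \<open>Linear functionals and evaluation at vertices of the cube\<close>

text \<open>Evaluation at a vertex and the pseudo-expectation of the lower bound both arise as linear
extensions of functions on monomials.\<close>

definition lin_ext :: "(monom \<Rightarrow> real) \<Rightarrow> mpoly \<Rightarrow> real" where
  "lin_ext h p = (\<Sum>m\<in>Poly_Mapping.keys p. Poly_Mapping.lookup p m * h m)"

lemma lin_ext_add: "lin_ext h (p + q) = lin_ext h p + lin_ext h q"
  unfolding lin_ext_def by (rule setsum_keys_plus_distrib[where f = "\<lambda>m c. c * h m"]) (auto simp: algebra_simps)

lemma lin_ext_0 [simp]: "lin_ext h 0 = 0"
  by (simp add: lin_ext_def)

lemma lin_ext_minus: "lin_ext h (- p) = - lin_ext h p"
  using lin_ext_add[of h p "- p"] by simp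

lemma lin_ext_diff: "lin_ext h (p - q) = lin_ext h p - lin_ext h q"
  using lin_ext_add[of h p "- q"] by (simp add: lin_ext_minus)

lemma lin_ext_sum: "lin_ext h (\<Sum>i\<in>I. p i) = (\<Sum>i\<in>I. lin_ext h (p i))"
  by (induction I rule: infinite_finite_induct) (simp_all add: lin_ext_add)

lemma lin_ext_single [simp]: "lin_ext h (Poly_Mapping.single m c) = c * h m"
  by (simp add: lin_ext_def)

lemma sum_single_keys: "(\<Sum>m\<in>Poly_Mapping.keys p. Poly_Mapping.single m (Poly_Mapping.lookup p m)) = p"
  by (rule poly_mapping_eqI) (simp add: lookup_sum lookup_single when_def in_keys_iff)

text \<open>This makes multiplicativity of evaluations, and the quadratic form attached to a functional,
visible on monomials.\<close>

lemma lin_ext_mult: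
  "lin_ext h (p * q) = (\<Sum>a\<in>Poly_Mapping.keys p. \<Sum>b\<in>Poly_Mapping.keys q.
     Poly_Mapping.lookup p a * Poly_Mapping.lookup q b * h (a + b))"
proof -
  have "p * q = (\<Sum>a\<in>Poly_Mapping.keys p. \<Sum>b\<in>Poly_Mapping.keys q.
      Poly_Mapping.single a (Poly_Mapping.lookup p a) * Poly_Mapping.single b (Poly_Mapping.lookup q b))"
    by (subst (1) sum_single_keys[of p, symmetric], subst (1) sum_single_keys[of q, symmetric])
       (simp add: sum_product)
  then show ?thesis by (simp add: lin_ext_sum mult_single)
qed

lemma keys_plus_monom: "Poly_Mapping.keys (a + b :: monom) = Poly_Mapping.keys a \<union> Poly_Mapping.keys b"
  by (auto simp: in_keys_iff lookup_add)

text \<open>At a vertex only the support of a monomial matters, so evaluation is the linear extension of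
a function of the support.\<close>

lemma eval_indicator_eq_lin_ext:
  "eval_poly (indicator S) p = lin_ext (\<lambda>m. of_bool (Poly_Mapping.keys m \<subseteq> S)) p"
proof -
  have "(\<Prod>k\<in>A. of_bool (k \<in> S)) = (of_bool (A \<subseteq> S) :: real)" if "finite A" for A
    using that by (induction A rule: finite_induct) auto
  moreover have "(\<Prod>k\<in>Poly_Mapping.keys m. indicator S k ^ Poly_Mapping.lookup m k) =
      (\<Prod>k\<in>Poly_Mapping.keys m. of_bool (k \<in> S) :: real)" for m :: monom
    by (intro prod.cong refl) (auto simp: indicator_def in_keys_iff)
  ultimately have "(\<Prod>k\<in>Poly_Mapping.keys m. indicator S k ^ Poly_Mapping.lookup m k) =
      (of_bool (Poly_Mapping.keys m \<subseteq> S) :: real)" for m :: monom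
    by simp
  then show ?thesis by (simp add: eval_poly_def lin_ext_def)
qed

lemma ev_add: "eval_poly (indicator S) (p + q) = eval_poly (indicator S) p + eval_poly (indicator S) q"
  and ev_minus: "eval_poly (indicator S) (- p) = - eval_poly (indicator S) p"
  and ev_diff: "eval_poly (indicator S) (p - q) = eval_poly (indicator S) p - eval_poly (indicator S) q"
  and ev_sum: "eval_poly (indicator S) (\<Sum>i\<in>I. f i) = (\<Sum>i\<in>I. eval_poly (indicator S) (f i))"
  and ev_0: "eval_poly (indicator S) 0 = 0"
  by (simp_all add: eval_indicator_eq_lin_ext lin_ext_add lin_ext_minus lin_ext_diff lin_ext_sum)

lemma ev_Const: "eval_poly (indicator S) (Const c) = c"
  and ev_X: "eval_poly (indicator S) (X i) = indicator S i"
  by (simp_all add: eval_indicator_eq_lin_ext Const_def X_def indicator_def)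

lemma ev_mult: "eval_poly (indicator S) (p * q) = eval_poly (indicator S) p * eval_poly (indicator S) q"
  unfolding eval_indicator_eq_lin_ext lin_ext_mult keys_plus_monom
  by (simp add: lin_ext_def sum_product of_bool_conj mult_ac del: sum_mult_of_bool_eq sum_of_bool_mult_eq)

lemma ev_power2: "eval_poly (indicator S) (p ^ 2) = (eval_poly (indicator S) p) ^ 2"
  by (simp add: power2_eq_square ev_mult)

lemmas ev_simps = ev_add ev_minus ev_diff ev_sum ev_0 ev_Const ev_X ev_mult ev_power2

section \<open>Degree bounds and polynomial subrings\<close>

lemma monom_degree_eq:
  assumes "finite A" "Poly_Mapping.keys m \<subseteq> A"
  shows "monom_degree m = (\<Sum>k\<in>A. Poly_Mapping.lookup m k)"
  unfolding monom_degree_def using assms by (intro sum.mono_neutral_left) (auto simp: in_keys_iff)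

lemma monom_degree_add: "monom_degree (a + b) = monom_degree a + monom_degree b"
proof -
  let ?A = "Poly_Mapping.keys a \<union> Poly_Mapping.keys b"
  have "monom_degree c = (\<Sum>k\<in>?A. Poly_Mapping.lookup c k)" if "Poly_Mapping.keys c \<subseteq> ?A" for c
    using that by (intro monom_degree_eq) auto
  then show ?thesis by (simp add: keys_plus_monom lookup_add sum.distrib)
qed

lemma total_degree_le_iff: "total_degree p \<le> t \<longleftrightarrow> (\<forall>m\<in>Poly_Mapping.keys p. monom_degree m \<le> t)"
  by (simp add: total_degree_def)

text \<open>The polynomials of degree at most $t$ in the variables from $V$, as one set that is closed
under the ring operations with the obvious effect on $t$.\<close>

definition polys :: "nat set \<Rightarrow> nat \<Rightarrow> mpoly set" where
  "polys V t = {p \<in> poly_ring V. total_degree p \<le> t}"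

lemma polys_iff: "p \<in> polys V t \<longleftrightarrow>
    (\<forall>m\<in>Poly_Mapping.keys p. Poly_Mapping.keys m \<subseteq> V \<and> monom_degree m \<le> t)"
  by (auto simp: polys_def poly_ring_def total_degree_le_iff)

lemma polys_Const: "Const c \<in> polys V t"
  by (simp add: polys_iff Const_def monom_degree_def)

lemma polys_X: "i \<in> V \<Longrightarrow> 1 \<le> t \<Longrightarrow> X i \<in> polys V t"
  by (auto simp: polys_iff X_def monom_degree_def lookup_single)

lemma polys_add: "p \<in> polys V t \<Longrightarrow> q \<in> polys V t \<Longrightarrow> p + q \<in> polys V t"
  using keys_add[of p q] by (fastforce simp: polys_iff)

lemma polys_minus: "p \<in> polys V t \<Longrightarrow> - p \<in> polys V t"
  by (simp add: polys_iff)

lemma polys_diff: "p \<in> polys V t \<Longrightarrow> q \<in> polys V t \<Longrightarrow> p - q \<in> polys V t"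
  using polys_add[of p V t "- q"] polys_minus[of q V t] by simp

lemma polys_mult:
  assumes "p \<in> polys V s" "q \<in> polys V t"
  shows "p * q \<in> polys V (s + t)"
  unfolding polys_iff
proof
  fix m assume "m \<in> Poly_Mapping.keys (p * q)"
  then obtain a b where "m = a + b" "a \<in> Poly_Mapping.keys p" "b \<in> Poly_Mapping.keys q"
    using keys_mult[of p q] by blast
  then show "Poly_Mapping.keys m \<subseteq> V \<and> monom_degree m \<le> s + t"
    using assms by (auto simp: polys_iff keys_plus_monom monom_degree_add intro!: add_mono)
qed

lemma polys_0: "0 \<in> polys V t"
  by (simp add: polys_iff)

lemma polys_sum: "(\<And>i. i \<in> I \<Longrightarrow> p i \<in> polys V t) \<Longrightarrow> sum p I \<in> polys V t"
  by (induction I rule: infinite_finite_induct) (auto intro: polys_add polys_0)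

lemma polys_mono: "p \<in> polys V s \<Longrightarrow> s \<le> t \<Longrightarrow> p \<in> polys V t"
  by (auto simp: polys_def)

lemma polys_in_ring: "p \<in> polys V t \<Longrightarrow> p \<in> poly_ring V"
  by (simp add: polys_def)

lemma poly_ring_polys: "p \<in> poly_ring V \<Longrightarrow> p \<in> polys V (total_degree p)"
  by (simp add: polys_def)

lemma poly_ring_add: "p \<in> poly_ring V \<Longrightarrow> q \<in> poly_ring V \<Longrightarrow> p + q \<in> poly_ring V"
  using keys_add[of p q] by (fastforce simp: poly_ring_def)

lemma poly_ring_minus: "p \<in> poly_ring V \<Longrightarrow> - p \<in> poly_ring V"
  by (simp add: poly_ring_def)

lemma poly_ring_mult: "p \<in> poly_ring V \<Longrightarrow> q \<in> poly_ring V \<Longrightarrow> p * q \<in> poly_ring V"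
  using polys_mult poly_ring_polys polys_in_ring by blast

lemma poly_ring_sum: "(\<And>i. i \<in> I \<Longrightarrow> p i \<in> poly_ring V) \<Longrightarrow> sum p I \<in> poly_ring V"
proof (induction I rule: infinite_finite_induct)
  case (insert i I)
  then show ?case by (simp add: poly_ring_add)
qed (simp_all add: poly_ring_def)

lemma poly_ring_diff: "p \<in> poly_ring V \<Longrightarrow> q \<in> poly_ring V \<Longrightarrow> p - q \<in> poly_ring V"
  using poly_ring_add[of p V "- q"] poly_ring_minus[of q V] by simp

section \<open>Polynomials vanishing on the cube\<close>

lemma gen_ideal_0: "0 \<in> gen_ideal V G"
  unfolding gen_ideal_def by (auto intro!: exI[of _ "{}"])

lemma gen_ideal_add:
  assumes "p \<in> gen_ideal V G" "q \<in> gen_ideal V G"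
  shows "p + q \<in> gen_ideal V G"
proof -
  obtain A c where A: "p = (\<Sum>g\<in>A. c g * g)" "finite A" "A \<subseteq> G" "\<forall>g\<in>A. c g \<in> poly_ring V"
    using assms(1) unfolding gen_ideal_def by blast
  obtain B d where B: "q = (\<Sum>g\<in>B. d g * g)" "finite B" "B \<subseteq> G" "\<forall>g\<in>B. d g \<in> poly_ring V"
    using assms(2) unfolding gen_ideal_def by blast
  let ?c = "\<lambda>g. if g \<in> A then c g else 0" and ?d = "\<lambda>g. if g \<in> B then d g else 0"
  have "p = (\<Sum>g\<in>A \<union> B. ?c g * g)" "q = (\<Sum>g\<in>A \<union> B. ?d g * g)"
    unfolding A(1) B(1) using A(2) B(2) by (auto intro!: sum.mono_neutral_cong_left)
  then have "p + q = (\<Sum>g\<in>A \<union> B. (?c g + ?d g) * g)"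
    by (simp only: sum.distrib[symmetric] distrib_right)
  moreover have "?c g + ?d g \<in> poly_ring V" for g
    using A(4) B(4) by (intro poly_ring_add) (auto simp: poly_ring_def)
  ultimately show ?thesis
    unfolding gen_ideal_def using A(2,3) B(2,3) by (auto intro!: exI[of _ "A \<union> B"] exI[of _ "\<lambda>g. ?c g + ?d g"])
qed

lemma gen_ideal_mult:
  assumes "p \<in> gen_ideal V G" "q \<in> poly_ring V"
  shows "q * p \<in> gen_ideal V G"
proof -
  obtain A c where A: "p = (\<Sum>g\<in>A. c g * g)" "finite A" "A \<subseteq> G" "\<forall>g\<in>A. c g \<in> poly_ring V"
    using assms(1) unfolding gen_ideal_def by blast
  have "q * p = (\<Sum>g\<in>A. (q * c g) * g)"
    by (simp add: A(1) sum_distrib_left mult.assoc)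
  then show ?thesis
    unfolding gen_ideal_def using A assms(2) by (auto intro!: exI[of _ A] exI[of _ "\<lambda>g. q * c g"] poly_ring_mult)
qed

lemma gen_ideal_generator: "g \<in> G \<Longrightarrow> g \<in> gen_ideal V G"
  unfolding gen_ideal_def
  by (auto intro!: exI[of _ "{g}"] exI[of _ "\<lambda>_. 1"] simp: poly_ring_def)

lemma gen_ideal_sum: "(\<And>i. i \<in> I \<Longrightarrow> p i \<in> gen_ideal V G) \<Longrightarrow> sum p I \<in> gen_ideal V G"
  by (induction I rule: infinite_finite_induct) (auto intro: gen_ideal_add gen_ideal_0)

lemma X_power2: "X k ^ 2 = Poly_Mapping.single (Poly_Mapping.single k 2) 1"
  by (simp add: X_def power2_eq_square mult_single single_add[symmetric] numeral_2_eq_2)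

text \<open>Multiplying by $x_k^2$ or by $x_k$ adds the same index to the support of a monomial. Hence any
functional that sees only supports annihilates the generators, and with them the ideal.\<close>

lemma lin_ext_keys_I2:
  assumes "p \<in> I2 V"
  shows "lin_ext (\<lambda>m. H (Poly_Mapping.keys m)) p = 0"
proof -
  obtain A c where A: "p = (\<Sum>g\<in>A. c g * g)" "A \<subseteq> {X k ^ 2 - X k | k. k \<in> V}"
    using assms unfolding I2_def gen_ideal_def by blast
  have "lin_ext (\<lambda>m. H (Poly_Mapping.keys m)) (c * (X k ^ 2 - X k)) = 0" for c k
    unfolding right_diff_distrib lin_ext_diff lin_ext_mult X_power2 unfolding X_def
    by (simp add: keys_plus_monom)
  then show ?thesis using A by (auto simp: lin_ext_sum intro!: sum.neutral)
qed

lemma ev_I2: "p \<in> I2 V \<Longrightarrow> eval_poly (indicator S) p = 0"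
  unfolding eval_indicator_eq_lin_ext by (rule lin_ext_keys_I2[where H = "\<lambda>A. of_bool (A \<subseteq> S)"])

text \<open>As long as some exponent is at least 2, a multiple of the generator for that variable lowers
it by one and keeps the support.\<close>

lemma monom_reduction:
  assumes "Poly_Mapping.keys m \<subseteq> V"
  shows "Poly_Mapping.single m 1 - Poly_Mapping.single (sqfree_monom (Poly_Mapping.keys m)) 1 \<in> I2 V"
  using assms
proof (induction "monom_degree m" arbitrary: m rule: less_induct)
  case less
  show ?case
  proof (cases "\<forall>k. Poly_Mapping.lookup m k \<le> 1")
    case True
    then show ?thesis by (simp add: sqfree_monom_keys I2_def gen_ideal_0)
  next
    case False
    then obtain k where k: "Poly_Mapping.lookup m k \<ge> 2" by (metis not_less_eq_eq numeral_2_eq_2 One_nat_def)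
    define a where "a = m - Poly_Mapping.single k 2"
    define m' where "m' = a + Poly_Mapping.single k 1"
    have m: "m = a + Poly_Mapping.single k 2"
      by (rule poly_mapping_eqI) (use k in \<open>auto simp: a_def lookup_add lookup_minus lookup_single when_def\<close>)
    have keys: "Poly_Mapping.keys m' = Poly_Mapping.keys m"
      by (simp add: m m'_def keys_plus_monom)
    have "monom_degree m' < monom_degree m"
      by (simp add: m m'_def monom_degree_add) (simp add: monom_degree_def)
    then have "Poly_Mapping.single m' 1 - Poly_Mapping.single (sqfree_monom (Poly_Mapping.keys m)) 1 \<in> I2 V"
      using less keys by metis
    moreover have "Poly_Mapping.single a 1 * (X k ^ 2 - X k) \<in> I2 V"
      unfolding I2_def
    proof (rule gen_ideal_mult[OF gen_ideal_generator])
      have "k \<in> V" using less.prems by (auto simp: m keys_plus_monom)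
      then show "X k ^ 2 - X k \<in> {X k ^ 2 - X k |k. k \<in> V}" by blast
      show "Poly_Mapping.single a 1 \<in> poly_ring V"
        using less.prems by (auto simp: m keys_plus_monom poly_ring_def)
    qed
    moreover have "Poly_Mapping.single a 1 * (X k ^ 2 - X k) = Poly_Mapping.single m 1 - Poly_Mapping.single m' 1"
      unfolding X_power2 unfolding X_def m m'_def by (simp add: right_diff_distrib mult_single)
    ultimately show ?thesis
      using gen_ideal_add unfolding I2_def by fastforce
  qed
qed

text \<open>A Nullstellensatz for the cube: replacing every monomial by the squarefree monomial with the
same support changes $p$ by an element of the ideal, and the resulting multilinear polynomial
vanishes at all vertices, so it is the multilinear extension of 0.\<close>

theorem in_I2_if_vanishing_on_cube:
  assumes V: "V \<subseteq> {1..n}" and p: "p \<in> poly_ring V"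
    and zero: "\<And>S. S \<subseteq> V \<Longrightarrow> eval_poly (indicator S) p = 0"
  shows "p \<in> I2 V"
proof -
  let ?sq = "\<lambda>m :: monom. sqfree_monom (Poly_Mapping.keys m)"
  define q where "q = (\<Sum>m\<in>Poly_Mapping.keys p. Poly_Mapping.single (?sq m) (Poly_Mapping.lookup p m))"
  have "p - q = (\<Sum>m\<in>Poly_Mapping.keys p. Const (Poly_Mapping.lookup p m) *
      (Poly_Mapping.single m 1 - Poly_Mapping.single (?sq m) 1))"
    unfolding q_def Const_def right_diff_distrib mult_single sum_subtractf
    by (simp add: sum_single_keys)
  also have "\<dots> \<in> I2 V"
    unfolding I2_def
  proof (intro gen_ideal_sum gen_ideal_mult)
    fix m assume "m \<in> Poly_Mapping.keys p"
    then show "Poly_Mapping.single m 1 - Poly_Mapping.single (?sq m) 1 \<in> gen_ideal V {X k ^ 2 - X k |k. k \<in> V}"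
      using p by (intro monom_reduction[unfolded I2_def]) (auto simp: poly_ring_def)
    show "Const (Poly_Mapping.lookup p m) \<in> poly_ring V" using polys_Const polys_in_ring by blast
  qed
  finally have pq: "p - q \<in> I2 V" .
  have keys_q: "\<exists>m'\<in>Poly_Mapping.keys p. m = ?sq m'" if "m \<in> Poly_Mapping.keys q" for m
  proof -
    have "Poly_Mapping.keys q \<subseteq> (\<Union>m\<in>Poly_Mapping.keys p. Poly_Mapping.keys (Poly_Mapping.single (?sq m) (Poly_Mapping.lookup p m)))"
      unfolding q_def by (rule keys_sum)
    with that show ?thesis by (auto split: if_splits)
  qed
  \<comment> \<open>$q$ is a candidate for the multilinear extension of 0 on the whole cube\<close>
  have q_ring: "q \<in> poly_ring V"
    using keys_q p by (fastforce simp: poly_ring_def keys_sqfree_monom)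
  have "multilinear q"
    unfolding multilinear_def using keys_q by (fastforce simp: lookup_sqfree_monom)
  moreover have "eval_poly (indicator S) q = 0" for S
  proof -
    have "eval_poly (indicator S) q = eval_poly (indicator (S \<inter> V)) q"
      unfolding eval_indicator_eq_lin_ext lin_ext_def using q_ring by (intro sum.cong) (auto simp: poly_ring_def)
    also have "\<dots> = 0"
      using zero[of "S \<inter> V"] ev_I2[OF pq, of "S \<inter> V"] by (simp add: ev_diff)
    finally show ?thesis .
  qed
  moreover have "q \<in> poly_ring {1..n}" using q_ring V by (auto simp: poly_ring_def)
  ultimately have "is_mle n (\<lambda>_. 0) q" by (simp add: is_mle_def)
  moreover have "is_mle n (\<lambda>_. 0) 0" by (simp add: is_mle_def poly_ring_def multilinear_def ev_0)
  ultimately have "q = 0" by (rule is_mle_unique)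
  with pq show ?thesis by simp
qed

section \<open>Second derivatives as second differences\<close>

lemma multilinear_partial_deriv:
  assumes "p \<in> ml_ring V"
  shows "partial_deriv i p \<in> ml_ring (V - {i})"
  unfolding partial_deriv_def
proof (rule ml_ring_sum)
  fix m assume "m \<in> Poly_Mapping.keys p"
  then have m: "Poly_Mapping.keys m \<subseteq> V" "\<And>k. Poly_Mapping.lookup m k \<le> 1"
    using assms by (auto simp: ml_ring_iff)
  have "Poly_Mapping.keys (m - Poly_Mapping.single i 1) \<subseteq> V - {i}"
    using m(2)[of i] m(1) by (auto simp: in_keys_iff lookup_minus lookup_single when_def split: if_splits)
  moreover have "Poly_Mapping.lookup (m - Poly_Mapping.single i 1) k \<le> 1" for k
    using m(2)[of k] by (simp add: lookup_minus)
  ultimately show "Poly_Mapping.single (m - Poly_Mapping.single i 1) (real (Poly_Mapping.lookup m i) * Poly_Mapping.lookup p m)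
      \<in> ml_ring (V - {i})"
    by (simp add: ml_ring_iff)
qed

text \<open>A multilinear polynomial is affine in $x_i$, so its derivative is the difference of its values
at $x_i = 1$ and $x_i = 0$.\<close>

lemma ev_partial_deriv:
  assumes "multilinear p" "i \<notin> S"
  shows "eval_poly (indicator S) (partial_deriv i p) =
    eval_poly (indicator (insert i S)) p - eval_poly (indicator S) p"
proof -
  have "real (Poly_Mapping.lookup m i) * of_bool (Poly_Mapping.keys (m - Poly_Mapping.single i 1) \<subseteq> S) =
      (of_bool (Poly_Mapping.keys m \<subseteq> insert i S) - of_bool (Poly_Mapping.keys m \<subseteq> S) :: real)"
    if "m \<in> Poly_Mapping.keys p" for m
  proof -
    have le: "Poly_Mapping.lookup m i \<le> 1" using assms(1) that by (auto simp: multilinear_def)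
    show ?thesis
    proof (cases "i \<in> Poly_Mapping.keys m")
      case True
      then have 1: "Poly_Mapping.lookup m i = 1" using le by (simp add: in_keys_iff)
      then have "Poly_Mapping.keys (m - Poly_Mapping.single i 1) = Poly_Mapping.keys m - {i}"
        by (auto simp: in_keys_iff lookup_minus lookup_single when_def split: if_splits)
      then show ?thesis using 1 True assms(2) by (auto simp: of_bool_def)
    next
      case False
      then have "Poly_Mapping.keys m \<subseteq> insert i S \<longleftrightarrow> Poly_Mapping.keys m \<subseteq> S" by blast
      then show ?thesis using False by (simp add: in_keys_iff)
    qed
  qed
  then show ?thesis
    unfolding partial_deriv_def ev_sum unfolding eval_indicator_eq_lin_ext lin_ext_single
    unfolding lin_ext_def sum_subtractf[symmetric]
    by (intro sum.cong refl) (metis (no_types, opaque_lifting) mult.assoc mult.commute right_diff_distrib)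
qed

lemma ev_second_partial_deriv:
  assumes "F \<in> ml_ring V" "i \<noteq> j" "i \<notin> S" "j \<notin> S"
  shows "eval_poly (indicator S) (partial_deriv i (partial_deriv j F)) =
    eval_poly (indicator (insert i (insert j S))) F - eval_poly (indicator (insert i S)) F
    - eval_poly (indicator (insert j S)) F + eval_poly (indicator S) F"
proof -
  have "multilinear F" "multilinear (partial_deriv j F)"
    using assms(1) multilinear_partial_deriv[OF assms(1)] by (auto simp: ml_ring_def)
  then show ?thesis using assms by (simp add: ev_partial_deriv insert_commute)
qed

lemma second_partial_deriv_in_ring:
  assumes "F \<in> ml_ring V"
  shows "- partial_deriv i (partial_deriv j F) \<in> poly_ring (V - {i, j})"
proof -
  have "V - {j} - {i} = V - {i, j}" by blast
  then show ?thesis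
    using multilinear_partial_deriv[OF multilinear_partial_deriv[OF assms, of j], of i]
    by (simp add: ml_ring_def poly_ring_minus)
qed

section \<open>Sums of squares\<close>

text \<open>The cone is built one square at a time, so that closure properties follow by induction without
handling the index of the summands.\<close>

inductive_set sos :: "nat set \<Rightarrow> nat \<Rightarrow> mpoly set" for V t where
  zero: "0 \<in> sos V t"
| step: "q \<in> polys V t \<Longrightarrow> p \<in> sos V t \<Longrightarrow> q ^ 2 + p \<in> sos V t"

lemma sos_power2: "q \<in> polys V t \<Longrightarrow> q ^ 2 \<in> sos V t"
  using sos.step[OF _ sos.zero] by fastforce

lemma sos_add: "p \<in> sos V t \<Longrightarrow> q \<in> sos V t \<Longrightarrow> p + q \<in> sos V t"
  by (induction rule: sos.induct) (auto simp: add.assoc intro: sos.intros)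

lemma sos_sum: "(\<And>i. i \<in> I \<Longrightarrow> p i \<in> sos V t) \<Longrightarrow> sum p I \<in> sos V t"
  by (induction I rule: infinite_finite_induct) (auto intro: sos_add sos.zero)

lemma sos_power2_mult:
  assumes "p \<in> sos V t" "q \<in> polys V d"
  shows "q ^ 2 * p \<in> sos V (d + t)"
  using assms(1)
proof induction
  case zero
  then show ?case by (simp add: sos.zero)
next
  case (step r p)
  have "q ^ 2 * (r ^ 2 + p) = (q * r) ^ 2 + q ^ 2 * p" by (simp add: distrib_left power_mult_distrib)
  then show ?case using step polys_mult[OF assms(2)] by (metis sos.step)
qed

lemma sos_scale:
  assumes "p \<in> sos V t" "0 \<le> c"
  shows "Const c * p \<in> sos V t"
proof -
  have "Const c = Const (sqrt c) ^ 2"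
    using assms(2) by (simp add: Const_def power2_eq_square mult_single)
  then show ?thesis using sos_power2_mult[OF assms(1) polys_Const[of "sqrt c" V 0]] by simp
qed

lemma sos_mono: "p \<in> sos V s \<Longrightarrow> s \<le> t \<Longrightarrow> p \<in> sos V t"
  by (induction rule: sos.induct) (auto intro: sos.intros polys_mono)

lemma sos_in_ring: "p \<in> sos V t \<Longrightarrow> p \<in> poly_ring V"
proof (induction rule: sos.induct)
  case zero
  then show ?case by (simp add: poly_ring_def)
next
  case (step q p)
  then show ?case unfolding power2_eq_square using polys_in_ring by (intro poly_ring_add poly_ring_mult) auto
qed

lemma sos_eq_sum:
  assumes "p \<in> sos V t"
  shows "\<exists>(m::nat) q. (\<forall>r\<in>{1..m}. q r \<in> polys V t) \<and> p = (\<Sum>r = 1..m. q r ^ 2)"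
  using assms
proof induction
  case zero
  then show ?case by (auto intro: exI[of _ 0])
next
  case (step q0 p)
  then obtain m q where q: "\<forall>r\<in>{1..m}. q r \<in> polys V t" "p = (\<Sum>r = 1..m::nat. q r ^ 2)" by blast
  let ?q = "q(Suc m := q0)"
  have "q0 ^ 2 + p = (\<Sum>r = 1..Suc m. ?q r ^ 2)"
    unfolding q(2) by (simp add: add.commute)
  moreover have "\<forall>r\<in>{1..Suc m}. ?q r \<in> polys V t" using q(1) step by auto
  ultimately show ?case by blast
qed

text \<open>Membership in the ideal is replaced by agreement at the vertices.\<close>

lemma sos_modI:
  assumes "V \<subseteq> {1..n}" "p \<in> poly_ring V" "w \<in> sos V t"
    and "\<And>S. S \<subseteq> V \<Longrightarrow> eval_poly (indicator S) p = eval_poly (indicator S) w"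
  shows "sos_mod V (I2 V) t p"
proof -
  obtain m q where q: "\<forall>r\<in>{1..m}. q r \<in> polys V t" "w = (\<Sum>r = 1..m::nat. q r ^ 2)"
    using sos_eq_sum[OF assms(3)] by blast
  have "p - w \<in> I2 V"
    using assms by (intro in_I2_if_vanishing_on_cube[of V n]) (auto intro: poly_ring_diff sos_in_ring simp: ev_diff)
  then show ?thesis unfolding sos_mod_def using q by (auto simp: polys_def)
qed

lemma sos_mod_nonneg:
  assumes "sos_mod V (I2 V) t p"
  shows "0 \<le> eval_poly (indicator S) p"
proof -
  obtain m q where "p - (\<Sum>r = 1..m::nat. q r ^ 2) \<in> I2 V"
    using assms unfolding sos_mod_def by blast
  from ev_I2[OF this, of S] have "eval_poly (indicator S) p = (\<Sum>r = 1..m. eval_poly (indicator S) (q r) ^ 2)"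
    by (simp add: ev_simps)
  then show ?thesis by (simp add: sum_nonneg)
qed

section \<open>A sum of squares for the product of two consecutive integers\<close>

text \<open>With $N$ variables of sum $s$ this is, up to a positive factor, the symmetrisation of
$(y_1-y_2)^2 \cdots (y_{2j-1}-y_{2j})^2$ on the cube.\<close>

definition pair_weight :: "nat \<Rightarrow> real \<Rightarrow> real \<Rightarrow> real" where
  "pair_weight j N s = (\<Prod>i<j. (s - real i) * (N - s - real i))"

lemma pair_weight_Suc: "pair_weight (Suc j) N s = s * (N - s) * pair_weight j (N - 2) (s - 1)"
  unfolding pair_weight_def prod.lessThan_Suc_shift by (auto intro!: arg_cong2[of _ _ _ _ "(*)"] prod.cong simp: algebra_simps)

text \<open>A square $(y_a-y_b)^2$ is nonzero only if exactly one of $y_a, y_b$ is 1; the other $N-2$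
variables then have the sum $s-1$. Multiplying by the weight of order $j$ in these variables and
summing over all $a \ne b$ gives the weight of order $j+1$, because
$\sum_{a \ne b} (y_a-y_b)^2 = 2 s (N-s)$. The variables may be any affine polynomials with values
0 and 1, in particular constants.\<close>

lemma pair_weight_sos:
  assumes "finite I" "\<And>i. i \<in> I \<Longrightarrow> Y i \<in> polys V 1"
    and "\<And>i S. i \<in> I \<Longrightarrow> S \<subseteq> V \<Longrightarrow> eval_poly (indicator S) (Y i) \<in> {0, 1}"
  shows "\<exists>w\<in>sos V j. \<forall>S\<subseteq>V. eval_poly (indicator S) w =
    pair_weight j (real (card I)) (\<Sum>i\<in>I. eval_poly (indicator S) (Y i))"
  using assms
proof (induction j arbitrary: I)
  case 0
  have "Const 1 ^ 2 \<in> sos V 0" by (intro sos_power2 polys_Const)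
  then show ?case by (intro bexI[of _ "Const 1 ^ 2"]) (auto simp: pair_weight_def ev_simps)
next
  case (Suc j)
  define P where "P = {(a, b). a \<in> I \<and> b \<in> I \<and> a \<noteq> b}"
  have "\<forall>ab\<in>P. \<exists>w\<in>sos V j. \<forall>S\<subseteq>V. eval_poly (indicator S) w =
    pair_weight j (real (card (I - {fst ab, snd ab}))) (\<Sum>i\<in>I - {fst ab, snd ab}. eval_poly (indicator S) (Y i))"
    using Suc.prems by (intro ballI Suc.IH) auto
  then obtain w where w: "\<And>ab. ab \<in> P \<Longrightarrow> w ab \<in> sos V j"
    and ev_w: "\<And>ab S. ab \<in> P \<Longrightarrow> S \<subseteq> V \<Longrightarrow> eval_poly (indicator S) (w ab) =
    pair_weight j (real (card (I - {fst ab, snd ab}))) (\<Sum>i\<in>I - {fst ab, snd ab}. eval_poly (indicator S) (Y i))"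
    by metis
  define W where "W = (\<Sum>ab\<in>P. Const (1/2) * ((Y (fst ab) - Y (snd ab)) ^ 2 * w ab))"
  have "W \<in> sos V (1 + j)"
    unfolding W_def using Suc.prems w
    by (intro sos_sum sos_scale sos_power2_mult polys_diff) (auto simp: P_def)
  moreover have "eval_poly (indicator S) W = pair_weight (Suc j) (real (card I)) (\<Sum>i\<in>I. eval_poly (indicator S) (Y i))"
    if S: "S \<subseteq> V" for S
  proof -
    define y where "y = (\<lambda>i. eval_poly (indicator S) (Y i))"
    have yi: "eval_poly (indicator S) (Y i) = y i" for i by (simp add: y_def)
    have y01: "y i = 0 \<or> y i = 1" if "i \<in> I" for i using Suc.prems(3)[OF that S] by (auto simp: y_def)
    let ?N = "real (card I)" and ?s = "sum y I"
    have "eval_poly (indicator S) W = (\<Sum>(a, b)\<in>P. (y a - y b) ^ 2 * (1/2 * pair_weight j (?N - 2) (?s - 1)))"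
      unfolding W_def ev_sum split_def
    proof (intro sum.cong refl)
      fix ab assume ab: "ab \<in> P"
      then obtain a b where ab': "ab = (a, b)" "a \<in> I" "b \<in> I" "a \<noteq> b" by (auto simp: P_def)
      have sub: "card {a, b} \<le> card I" using ab' Suc.prems(1) by (intro card_mono) auto
      have card: "real (card (I - {a, b})) = ?N - 2"
        using ab' Suc.prems(1) sub by (simp add: card_Diff_subset of_nat_diff)
      have sum: "sum y (I - {a, b}) = ?s - y a - y b"
        using ab' Suc.prems(1) by (simp add: sum_diff)
      have "(y a - y b) ^ 2 * pair_weight j (?N - 2) (?s - y a - y b) = (y a - y b) ^ 2 * pair_weight j (?N - 2) (?s - 1)"
        using y01[OF ab'(2)] y01[OF ab'(3)] by auto
      then show "eval_poly (indicator S) (Const (1/2) * ((Y (fst ab) - Y (snd ab)) ^ 2 * w ab)) =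
          (y (fst ab) - y (snd ab)) ^ 2 * (1/2 * pair_weight j (?N - 2) (?s - 1))"
        using ev_w[OF ab S] card sum by (simp add: ev_simps ab' yi)
    qed
    also have "\<dots> = (\<Sum>(a, b)\<in>P. (y a - y b) ^ 2) * (1/2 * pair_weight j (?N - 2) (?s - 1))"
      by (simp add: sum_distrib_right split_def)
    also have "(\<Sum>(a, b)\<in>P. (y a - y b) ^ 2) = (\<Sum>(a, b)\<in>I \<times> I. (y a - y b) ^ 2)"
      using Suc.prems(1) by (intro sum.mono_neutral_left) (auto simp: P_def)
    also have "\<dots> = (\<Sum>a\<in>I. \<Sum>b\<in>I. y a ^ 2 + y b ^ 2 - 2 * (y a * y b))"
      by (simp add: sum.cartesian_product power2_diff algebra_simps)
    also have "\<dots> = (\<Sum>a\<in>I. \<Sum>b\<in>I. y a + y b - 2 * (y a * y b))"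
    proof -
      have "y i ^ 2 = y i" if "i \<in> I" for i using y01[OF that] by auto
      then show ?thesis by simp
    qed
    also have "\<dots> = 2 * (?s * (?N - ?s))"
      by (simp add: sum.distrib sum_subtractf sum_distrib_left[symmetric] sum_distrib_right[symmetric] sum_product[symmetric] algebra_simps)
    finally show ?thesis by (simp add: pair_weight_Suc yi)
  qed
  ultimately show ?case by auto
qed

text \<open>With $P = z - z_0$ and $D_i = x_i - z_0$ this is Newton interpolation of $1/(z-z_0)$ at the
nodes $x_0, x_1, \dots$; positivity of the $D_i$ makes all coefficients positive.\<close>

lemma newton_telescope:
  fixes D :: "nat \<Rightarrow> real"
  assumes "\<And>i. i < m \<Longrightarrow> D i \<noteq> 0"
  shows "P * (\<Sum>j<m. (\<Prod>i<j. D i - P) / (\<Prod>i\<le>j. D i)) = 1 - (\<Prod>i<m. D i - P) / (\<Prod>i<m. D i)"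
  using assms
proof (induction m)
  case (Suc m)
  have "D m \<noteq> 0" "(\<Prod>i<m. D i) \<noteq> 0" using Suc.prems by auto
  then show ?case
    using Suc by (simp add: distrib_left lessThan_Suc_atMost[symmetric]) (simp add: field_simps)
qed simp

text \<open>Put $P = (s-k)(s-k-1)$ and $D_i = (k-i)(k+1-i)$. Then $D_i - P = (s-i)(2k+1-s-i)$, so the sum in
\<open>newton_telescope\<close> is a positive combination of the weights of order less than $k$.
Multiplied by $P^2$ it equals $P$ up to a multiple of $P \prod_{i<k} (D_i - P)$, which vanishes for
all $s \in \{0, \dots, 2k+1\}$.\<close>

lemma consecutive_product_sos:
  assumes I: "finite I" "card I = 2 * k + 1"
    and Y: "\<And>i. i \<in> I \<Longrightarrow> Y i \<in> polys V 1"
    and Y01: "\<And>i S. i \<in> I \<Longrightarrow> S \<subseteq> V \<Longrightarrow> eval_poly (indicator S) (Y i) \<in> {0, 1}"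
  shows "\<exists>w\<in>sos V (k + 1). \<forall>S\<subseteq>V. eval_poly (indicator S) w =
    ((\<Sum>i\<in>I. eval_poly (indicator S) (Y i)) - real k) * ((\<Sum>i\<in>I. eval_poly (indicator S) (Y i)) - real k - 1)"
proof -
  define s where "s = (\<lambda>S. \<Sum>i\<in>I. eval_poly (indicator S) (Y i))"
  define D where "D = (\<lambda>i. (real k - real i) * (real k + 1 - real i))"
  have Dpos: "D i > 0" if "i < k" for i using that by (simp add: D_def)
  have "\<forall>j. \<exists>w\<in>sos V j. \<forall>S\<subseteq>V. eval_poly (indicator S) w = pair_weight j (real (card I)) (s S)"
    unfolding s_def by (intro allI pair_weight_sos I Y Y01)
  then obtain w where w: "\<And>j. w j \<in> sos V j"
    and ev_w: "\<And>j S. S \<subseteq> V \<Longrightarrow> eval_poly (indicator S) (w j) = pair_weight j (real (card I)) (s S)" by metis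
  define q where "q = ((\<Sum>i\<in>I. Y i) - Const (real k)) * ((\<Sum>i\<in>I. Y i) - Const (real k + 1))"
  have q: "q \<in> polys V 2"
  proof -
    have "(\<Sum>i\<in>I. Y i) - Const c \<in> polys V 1" for c
      by (intro polys_diff polys_sum polys_Const Y)
    from polys_mult[OF this this] show ?thesis unfolding q_def one_add_one .
  qed
  define W where "W = (\<Sum>j<k. Const (1 / (\<Prod>i\<le>j. D i)) * (q ^ 2 * w j))"
  have "W \<in> sos V (k + 1)"
    unfolding W_def
  proof (intro sos_sum sos_scale)
    fix j assume j: "j \<in> {..<k}"
    then show "q ^ 2 * w j \<in> sos V (k + 1)"
      using sos_power2_mult[OF w[of j] q] by (auto intro: sos_mono)
    have "0 < (\<Prod>i\<le>j. D i)" using j Dpos by (intro prod_pos) auto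
    then show "0 \<le> 1 / (\<Prod>i\<le>j. D i)" by simp
  qed
  moreover have "eval_poly (indicator S) W = (s S - real k) * (s S - real k - 1)" if S: "S \<subseteq> V" for S
  proof -
    let ?P = "(s S - real k) * (s S - real k - 1)"
    have ev_q: "eval_poly (indicator S) q = ?P" by (simp add: q_def ev_simps s_def algebra_simps)
    have weight_eq: "pair_weight j (real (card I)) (s S) = (\<Prod>i<j. D i - ?P)" for j
      unfolding pair_weight_def D_def I(2) by (intro prod.cong refl) (simp add: algebra_simps)
    have "eval_poly (indicator S) W = ?P * (?P * (\<Sum>j<k. (\<Prod>i<j. D i - ?P) / (\<Prod>i\<le>j. D i)))"
      unfolding W_def ev_simps ev_q ev_w[OF S] weight_eq
      by (simp add: sum_distrib_left power2_eq_square mult.assoc)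
    also have "\<dots> = ?P * (1 - (\<Prod>i<k. D i - ?P) / (\<Prod>i<k. D i))"
      using Dpos by (subst newton_telescope) (auto simp: less_imp_neq[THEN not_sym])
    also have "\<dots> = ?P - ?P * (\<Prod>i<k. D i - ?P) / (\<Prod>i<k. D i)" by (simp add: algebra_simps)
    \<comment> \<open>$s$ is an integer between 0 and $2k+1$; away from $k$ and $k+1$, where $P$ vanishes, it is $i$ or
    $2k+1-i$ for some $i < k$\<close>
    also have "?P * (\<Prod>i<k. D i - ?P) = 0"
    proof -
      have "s S = real (card {i\<in>I. eval_poly (indicator S) (Y i) = 1})"
      proof -
        have "s S = (\<Sum>i\<in>I. of_bool (eval_poly (indicator S) (Y i) = 1))"
          unfolding s_def using Y01[OF _ S] by (intro sum.cong) auto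
        then show ?thesis using I(1) by (simp add: sum_of_bool_eq Int_def conj_commute)
      qed
      then obtain u where u: "s S = real u" "u \<le> 2 * k + 1"
        using card_mono[OF I(1), of "{i\<in>I. eval_poly (indicator S) (Y i) = 1}"] I(2) by auto
      have root: "D i - ?P = (s S - real i) * (2 * real k + 1 - s S - real i)" for i
        by (simp add: D_def algebra_simps)
      consider "u < k" | "u = k" | "u = k + 1" | "2 * k + 1 - u < k" using u(2) by linarith
      then show ?thesis
      proof cases
        case 1
        then have "\<exists>i\<in>{..<k}. D i - ?P = 0" unfolding root unfolding u(1) by (intro bexI[of _ u]) auto
        then show ?thesis by (simp add: prod_zero)
      next
        case 4
        then have "\<exists>i\<in>{..<k}. D i - ?P = 0" unfolding root unfolding u(1) using u(2)
          by (intro bexI[of _ "2 * k + 1 - u"]) (auto simp: of_nat_diff)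
        then show ?thesis by (simp add: prod_zero)
      qed (simp_all add: u(1))
    qed
    finally show ?thesis by simp
  qed
  ultimately show ?thesis unfolding s_def by blast
qed

section \<open>Positivity of a symmetric moment form\<close>

text \<open>This is $\binom{k+1/2}{j} / \binom{2k+1}{j}$: the product of any $j$ distinct ones
among $2k+1$ exchangeable 0/1 variables with sum $r$ has the expectation $\binom{r}{j} / \binom{2k+1}{j}$; here $r$ is
set to $k + 1/2$.\<close>

definition moment :: "nat \<Rightarrow> nat \<Rightarrow> real" where
  "moment k j = (\<Prod>i<j. (real k + 1/2 - real i) / (2 * real k + 1 - real i))"

lemma moment_0 [simp]: "moment k 0 = 1" by (simp add: moment_def)

lemma moment_Suc: "moment k (Suc j) = moment k j * ((real k + 1/2 - real j) / (2 * real k + 1 - real j))"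
  by (simp add: moment_def)

text \<open>Condition on exactly one of two given variables being 1: the other variables behave like
$2k+1$ exchangeable ones with sum $k + 1/2$. The left side belongs to the form for $k+1$, where the
factor $(x_a-x_b)^2$ contributes its two diagonal and two mixed terms.\<close>

lemma moment_shift:
  assumes "j \<le> 2 * k"
  shows "2 * moment (Suc k) (Suc j) - 2 * moment (Suc k) (Suc (Suc j)) = (real k + 3/2) / (2 * real k + 2) * moment k j"
  using assms
proof (induction j)
  case 0
  have "moment (Suc k) (Suc 0) = 1/2" by (simp add: moment_def field_simps)
  then show ?case by (simp add: moment_Suc[of _ "Suc 0"] field_simps)
next
  case (Suc j)
  have pos: "real j + 1 \<le> 2 * real k" using Suc.prems by linarith
  have rel: "2 * moment (Suc k) (Suc i) - 2 * moment (Suc k) (Suc (Suc i)) = moment (Suc k) (Suc i) * (2 * real k + 3) / (2 * real k + 2 - real i)"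
    if "real i \<le> 2 * real k" for i
    using that by (simp add: moment_Suc[of "Suc k" "Suc i"] field_simps)
  have IH: "moment (Suc k) (Suc j) * (2 * real k + 3) / (2 * real k + 2 - real j) = (real k + 3/2) / (2 * real k + 2) * moment k j"
    using Suc rel[of j] pos by simp
  have "2 * moment (Suc k) (Suc (Suc j)) - 2 * moment (Suc k) (Suc (Suc (Suc j)))
     = moment (Suc k) (Suc (Suc j)) * (2 * real k + 3) / (2 * real k + 2 - real (Suc j))"
    using rel[of "Suc j"] pos by simp
  also have "\<dots> = (moment (Suc k) (Suc j) * (2 * real k + 3) / (2 * real k + 2 - real j)) * ((real k + 1/2 - real j) / (2 * real k + 1 - real j))"
    using pos by (simp add: moment_Suc[of "Suc k" "Suc j"] divide_simps) (simp add: algebra_simps)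
  also have "\<dots> = (real k + 3/2) / (2 * real k + 2) * moment k (Suc j)"
    unfolding IH moment_Suc[of k j] by simp
  finally show ?case .
qed

definition small_subsets :: "nat \<Rightarrow> nat set \<Rightarrow> nat set set" where
  "small_subsets k V = {A. A \<subseteq> V \<and> card A \<le> k}"

lemma finite_small_subsets: "finite V \<Longrightarrow> finite (small_subsets k V)"
  by (rule finite_subset[of _ "Pow V"]) (auto simp: small_subsets_def)

text \<open>A multilinear polynomial is represented by its coefficients $c_A$ at the monomials
$\prod_{i \in A} x_i$. On the cube these monomials multiply by taking unions of index sets.\<close>

definition moment_form :: "nat \<Rightarrow> nat set \<Rightarrow> (nat set \<Rightarrow> real) \<Rightarrow> (nat set \<Rightarrow> real) \<Rightarrow> real" where
  "moment_form k V c d = (\<Sum>A\<in>small_subsets k V. \<Sum>B\<in>small_subsets k V. c A * d B * moment k (card (A \<union> B)))"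

lemma moment_form_commute: "moment_form k V c d = moment_form k V d c"
  unfolding moment_form_def by (subst sum.swap) (simp add: Un_commute mult.commute)

lemma moment_form_add_left: "moment_form k V (\<lambda>A. c A + c' A) d = moment_form k V c d + moment_form k V c' d"
  by (simp add: moment_form_def algebra_simps sum.distrib)

lemma moment_form_scale_left: "moment_form k V (\<lambda>A. r * c A) d = r * moment_form k V c d"
  by (simp add: moment_form_def sum_distrib_left mult.assoc)

lemma moment_form_sum_left: "finite I \<Longrightarrow> moment_form k V (\<lambda>A. \<Sum>i\<in>I. c i A) d = (\<Sum>i\<in>I. moment_form k V (c i) d)"
proof (induction I rule: finite_induct)
  case empty then show ?case by (simp add: moment_form_def)
next
  case (insert i I) then show ?case by (simp add: moment_form_add_left)
qed

abbreviation act :: "nat \<Rightarrow> nat \<Rightarrow> (nat set \<Rightarrow> real) \<Rightarrow> nat set \<Rightarrow> real" where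
  "act a b c \<equiv> \<lambda>A. c (transpose a b ` A)"

lemma bij_betw_transpose_small_subsets:
  assumes "a \<in> V" "b \<in> V"
  shows "bij_betw (image (transpose a b)) (small_subsets k V) (small_subsets k V)"
proof (rule bij_betwI[of _ _ _ "image (transpose a b)"])
  have "transpose a b ` A \<in> small_subsets k V" if "A \<in> small_subsets k V" for A
  proof -
    have "transpose a b ` A \<subseteq> V" using that assms by (auto simp: small_subsets_def transpose_def)
    moreover have "card (transpose a b ` A) = card A" by (simp add: card_image)
    ultimately show ?thesis using that by (simp add: small_subsets_def)
  qed
  then show "image (transpose a b) \<in> small_subsets k V \<rightarrow> small_subsets k V" "image (transpose a b) \<in> small_subsets k V \<rightarrow> small_subsets k V" by auto
qed (simp_all add: image_comp)

lemma moment_form_act: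
  assumes "a \<in> V" "b \<in> V"
  shows "moment_form k V (act a b c) (act a b d) = moment_form k V c d"
proof -
  have "moment k (card (A \<union> B)) = moment k (card (transpose a b ` A \<union> transpose a b ` B))" for A B
    by (simp add: card_image flip: image_Un)
  then have "moment_form k V (act a b c) (act a b d) = (\<Sum>A\<in>small_subsets k V. \<Sum>B\<in>small_subsets k V.
      c (transpose a b ` A) * d (transpose a b ` B) * moment k (card (transpose a b ` A \<union> transpose a b ` B)))"
    by (simp add: moment_form_def)
  also have "\<dots> = (\<Sum>A\<in>small_subsets k V. \<Sum>B\<in>small_subsets k V. c (transpose a b ` A) * d B * moment k (card (transpose a b ` A \<union> B)))"
    by (rule sum.cong[OF refl])
       (rule sum.reindex_bij_betw[OF bij_betw_transpose_small_subsets[OF assms],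
          where g = "\<lambda>B. c (transpose a b ` A) * d B * moment k (card (transpose a b ` A \<union> B))" for A])
  also have "\<dots> = moment_form k V c d"
    unfolding moment_form_def
    by (rule sum.reindex_bij_betw[OF bij_betw_transpose_small_subsets[OF assms],
          where g = "\<lambda>A. \<Sum>B\<in>small_subsets k V. c A * d B * moment k (card (A \<union> B))"])
  finally show ?thesis .
qed

text \<open>An antisymmetric coefficient function vanishes on sets that contain both or none of $a, b$,
and the sets that contain exactly one of them come in pairs with opposite values.\<close>

lemma sum_small_subsets_antisymmetric:
  fixes e h :: "nat set \<Rightarrow> real"
  assumes V: "finite V" "a \<in> V" "b \<in> V" "a \<noteq> b"
    and e: "\<And>A. e (transpose a b ` A) = - e A"
  shows "(\<Sum>A\<in>small_subsets (Suc k) V. e A * h A) =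
    (\<Sum>A\<in>small_subsets k (V - {a, b}). e (insert a A) * (h (insert a A) - h (insert b A)))"
proof -
  let ?L = "small_subsets k (V - {a, b})"
  have fin: "finite A" if "A \<in> ?L" for A using that V finite_subset by (auto simp: small_subsets_def)
  have notin: "a \<notin> A" "b \<notin> A" if "A \<in> ?L" for A using that by (auto simp: small_subsets_def)
  have eb: "e (insert b A) = - e (insert a A)" if "A \<in> ?L" for A
  proof -
    have "transpose a b ` insert a A = insert b A"
      using notin[OF that] by (force simp: transpose_def image_iff)
    then show ?thesis using e[of "insert a A"] by simp
  qed
  have z: "e A = 0" if "a \<in> A \<longleftrightarrow> b \<in> A" for A
  proof -
    have "transpose a b ` A = A" using that by (rule transpose_image_eq)
    then show ?thesis using e[of A] by simp
  qed
  have sub: "insert a ` ?L \<union> insert b ` ?L \<subseteq> small_subsets (Suc k) V"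
  proof -
    have "insert x A \<in> small_subsets (Suc k) V" if "A \<in> ?L" "x \<in> V" for x A
      using that fin[OF that(1)] by (auto simp: small_subsets_def card_insert_if)
    then show ?thesis using V by blast
  qed
  have "(\<Sum>A\<in>small_subsets (Suc k) V. e A * h A) = (\<Sum>A\<in>insert a ` ?L \<union> insert b ` ?L. e A * h A)"
  proof (rule sum.mono_neutral_right[OF finite_small_subsets[OF V(1)] sub], intro ballI)
    fix A assume "A \<in> small_subsets (Suc k) V - (insert a ` ?L \<union> insert b ` ?L)"
    then have A: "A \<in> small_subsets (Suc k) V" "A \<notin> insert a ` ?L" "A \<notin> insert b ` ?L" by auto
    have "finite A" using A V finite_subset by (auto simp: small_subsets_def)
    have "a \<in> A \<longleftrightarrow> b \<in> A"
    proof (rule ccontr)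
      assume ab: "\<not> (a \<in> A \<longleftrightarrow> b \<in> A)"
      then consider "a \<in> A" "b \<notin> A" | "b \<in> A" "a \<notin> A" by blast
      then show False
      proof cases
        case 1
        then have "A - {a} \<in> ?L" "A = insert a (A - {a})" using A(1) \<open>finite A\<close> by (auto simp: small_subsets_def)
        then show False using A by blast
      next
        case 2
        then have "A - {b} \<in> ?L" "A = insert b (A - {b})" using A(1) \<open>finite A\<close> by (auto simp: small_subsets_def)
        then show False using A by blast
      qed
    qed
    then show "e A * h A = 0" using z by simp
  qed
  also have "\<dots> = (\<Sum>A\<in>insert a ` ?L. e A * h A) + (\<Sum>A\<in>insert b ` ?L. e A * h A)"
    using V finite_small_subsets[of "V - {a,b}" k] notin by (intro sum.union_disjoint) auto
  also have "\<dots> = (\<Sum>A\<in>?L. e (insert a A) * h (insert a A)) + (\<Sum>A\<in>?L. e (insert b A) * h (insert b A))"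
  proof -
    have "inj_on (insert a) ?L" "inj_on (insert b) ?L"
      using notin by (auto intro!: inj_onI dest!: insert_ident[THEN iffD1, rotated -1])
    then show ?thesis by (simp add: sum.reindex)
  qed
  also have "\<dots> = (\<Sum>A\<in>?L. e (insert a A) * (h (insert a A) - h (insert b A)))"
    unfolding sum.distrib[symmetric] by (intro sum.cong refl) (simp add: eb algebra_simps)
  finally show ?thesis .
qed

text \<open>Such an $e$ is the coefficient function of $(x_a-x_b) g$, where $g$ has lower degree and does not
involve $x_a, x_b$; the coefficient of $g$ at $A$ is that of $(x_a-x_b) g$ at $A \cup \{a\}$.\<close>

lemma moment_form_antisymmetric:
  assumes V: "finite V" "a \<in> V" "b \<in> V" "a \<noteq> b"
    and e: "\<And>A. e (transpose a b ` A) = - e A"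
  shows "moment_form (Suc k) V e e = (real k + 3/2) / (2 * real k + 2) *
    moment_form k (V - {a, b}) (\<lambda>A. e (insert a A)) (\<lambda>A. e (insert a A))"
proof -
  let ?L = "small_subsets k (V - {a, b})"
  let ?d = "\<lambda>A. e (insert a A)"
  let ?g = "\<lambda>A B. moment (Suc k) (card (A \<union> B))"
  have inner: "(\<Sum>B\<in>small_subsets (Suc k) V. e B * ?g A B) =
     (\<Sum>B\<in>?L. ?d B * (?g A (insert a B) - ?g A (insert b B)))" for A
    by (rule sum_small_subsets_antisymmetric[OF V, where e = e, OF e])
  have "moment_form (Suc k) V e e = (\<Sum>A\<in>small_subsets (Suc k) V. e A * (\<Sum>B\<in>small_subsets (Suc k) V. e B * ?g A B))"
    by (simp add: moment_form_def sum_distrib_left mult.assoc)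
  also have "\<dots> = (\<Sum>A\<in>?L. ?d A * ((\<Sum>B\<in>?L. ?d B * (?g (insert a A) (insert a B) - ?g (insert a A) (insert b B)))
      - (\<Sum>B\<in>?L. ?d B * (?g (insert b A) (insert a B) - ?g (insert b A) (insert b B)))))"
    unfolding inner by (rule sum_small_subsets_antisymmetric[OF V, where e = e, OF e])
  also have "\<dots> = (\<Sum>A\<in>?L. \<Sum>B\<in>?L. ?d A * ?d B * ((real k + 3/2) / (2 * real k + 2) * moment k (card (A \<union> B))))"
    unfolding sum_subtractf[symmetric] sum_distrib_left
  proof (intro sum.cong refl)
    fix A B assume AB: "A \<in> ?L" "B \<in> ?L"
    then have fin: "finite (A \<union> B)" and ab: "a \<notin> A \<union> B" "b \<notin> A \<union> B"
      using V finite_subset by (auto simp: small_subsets_def)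
    have "card (A \<union> B) \<le> 2 * k" using AB card_Un_le[of A B] by (auto simp: small_subsets_def)
    note * = moment_shift[OF this]
    have 1: "card (insert a A \<union> insert a B) = Suc (card (A \<union> B))" "card (insert b A \<union> insert b B) = Suc (card (A \<union> B))"
      using fin ab by simp_all
    have "insert b A \<union> insert a B = insert a (insert b (A \<union> B))" "insert a A \<union> insert b B = insert a (insert b (A \<union> B))"
      by auto
    then have 2: "card (insert a A \<union> insert b B) = Suc (Suc (card (A \<union> B)))" "card (insert b A \<union> insert a B) = Suc (Suc (card (A \<union> B)))"
      using fin ab V(4) by simp_all
    show "?d A * (?d B * (?g (insert a A) (insert a B) - ?g (insert a A) (insert b B)) - ?d B * (?g (insert b A) (insert a B) - ?g (insert b A) (insert b B)))
       = ?d A * ?d B * ((real k + 3/2) / (2 * real k + 2) * moment k (card (A \<union> B)))"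
      unfolding *[symmetric] 1 2 by (simp add: algebra_simps)
  qed
  also have "\<dots> = (real k + 3/2) / (2 * real k + 2) * moment_form k (V - {a, b}) ?d ?d"
    unfolding moment_form_def sum_distrib_left by (intro sum.cong refl) (simp add: algebra_simps)
  finally show ?thesis .
qed

text \<open>If $q$ is symmetric in the variables of $W$, its average $p$ over the exchanges of $m$ with the
elements of $W \cup \{m\}$ is symmetric in $W \cup \{m\}$. By invariance of the form
$B(p,p) = B(p,q)$, which is an average of the values $B(\tau q, q)$, and each of them is at most
$B(q,q)$ because the form is nonnegative at the antisymmetric $q - \tau q$.\<close>

lemma moment_form_symmetrise_step:
  assumes W: "finite W" "m \<notin> W" "insert m W \<subseteq> V"
    and anti: "\<And>a b e. a \<in> V \<Longrightarrow> b \<in> V \<Longrightarrow> a \<noteq> b \<Longrightarrow> (\<And>A. e (transpose a b ` A) = - e A) \<Longrightarrow> 0 \<le> moment_form k V e e"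
    and q: "\<And>a b. a \<in> W \<Longrightarrow> b \<in> W \<Longrightarrow> act a b q = q"
  shows "\<exists>p. (\<forall>a\<in>insert m W. \<forall>b\<in>insert m W. act a b p = p) \<and> moment_form k V p p \<le> moment_form k V q q"
proof -
  define r where "r = 1 / real (card (insert m W))"
  have r: "r > 0" using W by (simp add: r_def)
  define p where "p = (\<lambda>A. r * (\<Sum>a\<in>insert m W. act a m q A))"
  have qb: "q (transpose a b ` A) = q A" if "a \<in> W" "b \<in> W" for a b A
    using q[OF that] by (rule fun_cong)
  \<comment> \<open>conjugation by a permutation of $W$ turns the exchange of $a$ and $m$ into another one of this kind\<close>
  have conj: "q (transpose a m ` transpose b c ` A) = q (transpose (transpose b c a) m ` A)"
    if "a \<in> W" "b \<in> W" "c \<in> W" for a b c A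
  proof -
    have "transpose a m \<circ> transpose b c = transpose b c \<circ> transpose (transpose b c a) m"
      using that W(2) by (auto simp: fun_eq_iff transpose_def)
    then have "transpose a m ` transpose b c ` A = transpose b c ` transpose (transpose b c a) m ` A"
      by (metis image_comp)
    then show ?thesis using qb[OF that(2,3)] by simp
  qed
  have invW: "act b c p = p" if bc: "b \<in> W" "c \<in> W" for b c
  proof
    fix A
    have "(\<Sum>a\<in>insert m W. q (transpose a m ` transpose b c ` A)) = (\<Sum>a\<in>insert m W. q (transpose (transpose b c a) m ` A))"
    proof (rule sum.cong[OF refl])
      fix a assume "a \<in> insert m W"
      moreover have "transpose b c m = m" using bc W(2) by (auto simp: transpose_def)
      ultimately show "q (transpose a m ` transpose b c ` A) = q (transpose (transpose b c a) m ` A)"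
        using conj[of a b c A] qb[OF bc, of A] bc by (auto)
    qed
    also have "\<dots> = (\<Sum>a\<in>insert m W. q (transpose a m ` A))"
    proof (rule sum.reindex_bij_betw[where g = "\<lambda>a. q (transpose a m ` A)"])
      show "bij_betw (transpose b c) (insert m W) (insert m W)"
        using bc by (intro bij_betwI[of _ _ _ "transpose b c"]) (auto simp: transpose_def)
    qed
    finally show "p (transpose b c ` A) = p A" by (simp add: p_def)
  qed
  have invm: "act b m p = p" if b: "b \<in> W" for b
  proof
    fix A
    have "(\<Sum>a\<in>insert m W. q (transpose a m ` transpose b m ` A)) = (\<Sum>a\<in>insert m W. q (transpose (transpose b m a) m ` A))"
    proof (rule sum.cong[OF refl])
      fix a assume a: "a \<in> insert m W"
      consider "a = m" | "a = b" | "a \<in> W" "a \<noteq> b" "a \<noteq> m" using a by auto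
      then show "q (transpose a m ` transpose b m ` A) = q (transpose (transpose b m a) m ` A)"
      proof cases
        case 3
        have "transpose a m \<circ> transpose b m = transpose a b \<circ> transpose a m"
          using 3 W(2) b by (auto simp: fun_eq_iff transpose_def)
        then have "transpose a m ` transpose b m ` A = transpose a b ` transpose a m ` A"
          by (metis image_comp)
        then show ?thesis using qb[OF 3(1) b] 3 by (simp add: transpose_def)
      qed (simp_all add: image_comp)
    qed
    also have "\<dots> = (\<Sum>a\<in>insert m W. q (transpose a m ` A))"
    proof (rule sum.reindex_bij_betw[where g = "\<lambda>a. q (transpose a m ` A)"])
      show "bij_betw (transpose b m) (insert m W) (insert m W)"
        using b by (intro bij_betwI[of _ _ _ "transpose b m"]) (auto simp: transpose_def)
    qed
    finally show "p (transpose b m ` A) = p A" by (simp add: p_def)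
  qed
  have inv: "act a b p = p" if "a \<in> insert m W" "b \<in> insert m W" for a b
    using that invW[of a b] invm[of a] invm[of b] by (auto simp: transpose_commute[of m])
  have formp: "moment_form k V p d = r * (\<Sum>a\<in>insert m W. moment_form k V (act a m q) d)" for d
    unfolding p_def using W(1) by (simp add: moment_form_scale_left moment_form_sum_left del: sum.insert)
  have "moment_form k V p p = r * (\<Sum>a\<in>insert m W. moment_form k V (act a m q) p)"
    by (rule formp)
  also have "\<dots> = r * (\<Sum>a\<in>insert m W. moment_form k V q p)"
  proof -
    have "moment_form k V (act a m q) p = moment_form k V q p" if "a \<in> insert m W" for a
    proof -
      have "moment_form k V (act a m q) p = moment_form k V (act a m q) (act a m p)" using inv[of a m] that by simp
      also have "\<dots> = moment_form k V q p" using that W by (intro moment_form_act) auto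
      finally show ?thesis .
    qed
    then show ?thesis by simp
  qed
  also have "\<dots> = moment_form k V p q" using W by (simp add: r_def moment_form_commute)
  also have "\<dots> = r * (\<Sum>a\<in>insert m W. moment_form k V (act a m q) q)" by (rule formp)
  also have "\<dots> \<le> r * (\<Sum>a\<in>insert m W. moment_form k V q q)"
  proof (intro mult_left_mono sum_mono)
    fix a assume a: "a \<in> insert m W"
    show "moment_form k V (act a m q) q \<le> moment_form k V q q"
    proof (cases "a = m")
      case False
      let ?e = "\<lambda>A. q A + (-1) * act a m q A"
      have "0 \<le> moment_form k V ?e ?e"
        using a W False by (intro anti[of a m]) (auto simp: image_comp)
      also have "\<dots> = moment_form k V q ?e - moment_form k V (act a m q) ?e"
        unfolding moment_form_add_left moment_form_scale_left by simp
      also have "\<dots> = moment_form k V ?e q - moment_form k V ?e (act a m q)" by (simp only: moment_form_commute)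
      also have "\<dots> = moment_form k V q q - moment_form k V (act a m q) q - (moment_form k V q (act a m q) - moment_form k V (act a m q) (act a m q))"
        unfolding moment_form_add_left moment_form_scale_left by simp
      also have "\<dots> = 2 * (moment_form k V q q - moment_form k V (act a m q) q)"
        using moment_form_act[of a V m k q q] moment_form_commute[of k V q "act a m q"] a W by auto
      finally show ?thesis by simp
    qed simp
  qed (use r in simp)
  also have "\<dots> = moment_form k V q q" using W by (simp add: r_def)
  finally show ?thesis using inv by blast
qed

lemma moment_form_symmetrise:
  assumes "finite W" "W \<subseteq> V"
    and anti: "\<And>a b e. a \<in> V \<Longrightarrow> b \<in> V \<Longrightarrow> a \<noteq> b \<Longrightarrow> (\<And>A. e (transpose a b ` A) = - e A) \<Longrightarrow> 0 \<le> moment_form k V e e"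
  shows "\<exists>p. (\<forall>a\<in>W. \<forall>b\<in>W. act a b p = p) \<and> moment_form k V p p \<le> moment_form k V q q"
  using assms(1,2)
proof (induction W rule: finite_induct)
  case empty
  then show ?case by auto
next
  case (insert m W)
  then obtain p where p: "\<forall>a\<in>W. \<forall>b\<in>W. act a b p = p" "moment_form k V p p \<le> moment_form k V q q" by auto
  have "\<exists>p'. (\<forall>a\<in>insert m W. \<forall>b\<in>insert m W. act a b p' = p') \<and> moment_form k V p' p' \<le> moment_form k V p p"
  proof (rule moment_form_symmetrise_step[OF insert.hyps insert.prems])
    show "act a b p = p" if "a \<in> W" "b \<in> W" for a b using p(1) that by blast
  qed (rule anti)
  with p(2) show ?case by (meson order_trans)
qed

lemma symmetric_eq_of_card_eq:
  assumes "finite V" and inv: "\<And>a b. a \<in> V \<Longrightarrow> b \<in> V \<Longrightarrow> act a b p = p"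
    and "A \<subseteq> V" "B \<subseteq> V" "card A = card B"
  shows "p A = p B"
  using assms(3-)
proof (induction "card (A - B)" arbitrary: A)
  case 0
  have "finite A" "finite B" using 0 assms(1) finite_subset by blast+
  then have "A \<subseteq> B" using 0 by simp
  then have "A = B" using 0 \<open>finite B\<close> card_subset_eq by blast
  then show ?case by simp
next
  case (Suc m)
  have fin: "finite A" "finite B" using Suc assms(1) finite_subset by blast+
  obtain a where a: "a \<in> A" "a \<notin> B" using Suc.hyps(2) by (metis DiffE card.empty equals0I nat.distinct(1))
  have "\<not> B \<subseteq> A" using a fin Suc.prems by (metis card_subset_eq)
  then obtain b where b: "b \<in> B" "b \<notin> A" by blast
  have im: "transpose a b ` A = insert b (A - {a})"
    using a b by (force simp: transpose_def image_iff)
  have "insert b (A - {a}) - B = (A - B) - {a}" using a b by auto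
  then have "m = card (transpose a b ` A - B)" using Suc.hyps(2) a fin im by simp
  moreover have "transpose a b ` A \<subseteq> V" using im b Suc.prems by auto
  ultimately have "p (transpose a b ` A) = p B" using Suc.prems by (intro Suc.hyps) (auto simp: card_image)
  moreover have "a \<in> V" "b \<in> V" using a b Suc.prems by auto
  ultimately show ?case using fun_cong[OF inv[of a b], of A] by simp
qed

text \<open>Multiplying the elementary symmetric polynomial $e_i$ by the sum of the variables gives
$i e_i + (i+1) e_{i+1}$ on the cube.\<close>

lemma sum_insert_subsets_of_card:
  assumes "finite V"
  shows "(\<Sum>A | A \<subseteq> V \<and> card A = i. \<Sum>v\<in>V. h (insert v A)) =
    real i * (\<Sum>A | A \<subseteq> V \<and> card A = i. h A) + real (Suc i) * (\<Sum>A | A \<subseteq> V \<and> card A = Suc i. h A :: real)"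
proof -
  let ?S = "\<lambda>i. {A. A \<subseteq> V \<and> card A = i}"
  have fS: "finite (?S i)" for i using assms by (auto intro: finite_subset[of _ "Pow V"])
  have fA: "finite A" if "A \<subseteq> V" for A using that assms finite_subset by blast
  have "(\<Sum>A\<in>?S i. \<Sum>v\<in>V. h (insert v A)) = (\<Sum>A\<in>?S i. (\<Sum>v\<in>A. h A) + (\<Sum>v\<in>V - A. h (insert v A)))"
  proof (rule sum.cong[OF refl])
    fix A assume A: "A \<in> ?S i"
    then have "(\<Sum>v\<in>V. h (insert v A)) = (\<Sum>v\<in>V - A. h (insert v A)) + (\<Sum>v\<in>A. h (insert v A))"
      using assms by (intro sum.subset_diff) auto
    moreover have "(\<Sum>v\<in>A. h (insert v A)) = (\<Sum>v\<in>A. h A)" by (intro sum.cong) (auto simp: insert_absorb)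
    ultimately show "(\<Sum>v\<in>V. h (insert v A)) = (\<Sum>v\<in>A. h A) + (\<Sum>v\<in>V - A. h (insert v A))" by simp
  qed
  also have "\<dots> = real i * (\<Sum>A\<in>?S i. h A) + (\<Sum>A\<in>?S i. \<Sum>v\<in>V - A. h (insert v A))"
    by (simp add: sum.distrib sum_distrib_left)
  also have "(\<Sum>A\<in>?S i. \<Sum>v\<in>V - A. h (insert v A)) = (\<Sum>B\<in>?S (Suc i). \<Sum>v\<in>B. h B)"
  proof -
    have "(\<Sum>A\<in>?S i. \<Sum>v\<in>V - A. h (insert v A)) = (\<Sum>(A, v)\<in>Sigma (?S i) (\<lambda>A. V - A). h (insert v A))"
      using fS assms by (subst sum.Sigma) auto
    also have "\<dots> = (\<Sum>(B, v)\<in>Sigma (?S (Suc i)) (\<lambda>B. B). h B)"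
      by (rule sum.reindex_bij_witness[of _ "\<lambda>(B, v). (B - {v}, v)" "\<lambda>(A, v). (insert v A, v)"])
         (auto simp: fA insert_absorb card_Diff_singleton_if)
    also have "\<dots> = (\<Sum>B\<in>?S (Suc i). \<Sum>v\<in>B. h B)"
      using fS fA by (subst sum.Sigma) auto
    finally show ?thesis .
  qed
  also have "\<dots> = real (Suc i) * (\<Sum>B\<in>?S (Suc i). h B)"
    by (simp add: sum_distrib_left)
  finally show ?thesis .
qed

text \<open>The moments satisfy the relation that the sum of the variables is $r = k + 1/2$, against every
monomial of degree at most $2k$. With the preceding recurrence, $e_i$ therefore acts as the scalar
$\binom{r}{i}$.\<close>

lemma sum_moment_Un_card:
  assumes "finite V" "card V = 2 * k + 1" "B \<subseteq> V" "card B \<le> k" "i \<le> k"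
  shows "(\<Sum>A | A \<subseteq> V \<and> card A = i. moment k (card (A \<union> B))) = ((real k + 1/2) gchoose i) * moment k (card B)"
  using assms(5)
proof (induction i)
  case 0
  have "{A. A \<subseteq> V \<and> card A = 0} = {{}}" using finite_subset[OF _ assms(1)] by (auto simp: card_eq_0_iff)
  then show ?case by simp
next
  case (Suc i)
  let ?h = "\<lambda>i. \<Sum>A | A \<subseteq> V \<and> card A = i. moment k (card (A \<union> B))"
  have insert: "(\<Sum>v\<in>V. moment k (card (insert v C))) = (real k + 1/2) * moment k (card C)"
    if C: "C \<subseteq> V" "card C \<le> 2 * k" for C
  proof -
    have fC: "finite C" using C assms(1) finite_subset by blast
    have "(\<Sum>v\<in>V. moment k (card (insert v C))) = (\<Sum>v\<in>V - C. moment k (card (insert v C))) + (\<Sum>v\<in>C. moment k (card (insert v C)))"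
      using assms C by (intro sum.subset_diff) auto
    also have "(\<Sum>v\<in>C. moment k (card (insert v C))) = (\<Sum>v\<in>C. moment k (card C))"
      by (intro sum.cong) (auto simp: insert_absorb)
    also have "(\<Sum>v\<in>V - C. moment k (card (insert v C))) = (\<Sum>v\<in>V - C. moment k (Suc (card C)))"
      using fC by (intro sum.cong) auto
    also have "\<dots> + (\<Sum>v\<in>C. moment k (card C)) = (real (2 * k + 1) - real (card C)) * moment k (Suc (card C)) + real (card C) * moment k (card C)"
      using C assms fC by (simp add: card_Diff_subset of_nat_diff)
    also have "\<dots> = (real k + 1/2) * moment k (card C)"
    proof -
      have "real (card C) \<le> 2 * real k" using C(2) by linarith
      then show ?thesis by (simp add: moment_Suc field_simps)
    qed
    finally show ?thesis .
  qed
  have "real i * ?h i + real (Suc i) * ?h (Suc i) = (\<Sum>A | A \<subseteq> V \<and> card A = i. \<Sum>v\<in>V. moment k (card (insert v A \<union> B)))"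
    by (rule sum_insert_subsets_of_card[OF assms(1), symmetric])
  also have "\<dots> = (\<Sum>A | A \<subseteq> V \<and> card A = i. (real k + 1/2) * moment k (card (A \<union> B)))"
  proof (rule sum.cong[OF refl])
    fix A assume "A \<in> {A. A \<subseteq> V \<and> card A = i}"
    then show "(\<Sum>v\<in>V. moment k (card (insert v A \<union> B))) = (real k + 1/2) * moment k (card (A \<union> B))"
      using insert[of "A \<union> B"] assms Suc.prems card_Un_le[of A B] by simp
  qed
  also have "\<dots> = (real k + 1/2) * ?h i" by (simp add: sum_distrib_left)
  finally have "real (Suc i) * ?h (Suc i) = (real k + 1/2 - real i) * ?h i" by (simp add: algebra_simps)
  also have "\<dots> = (real k + 1/2 - real i) * ((real k + 1/2) gchoose i) * moment k (card B)"
    using Suc by simp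
  also have "\<dots> = real (Suc i) * (((real k + 1/2) gchoose Suc i) * moment k (card B))"
    using gbinomial_absorb_comp[of "real k + 1/2" i] gbinomial_absorption[of i "real k + 1/2"]
    by simp
  finally show ?case by (simp del: of_nat_Suc)
qed

text \<open>A symmetric polynomial acts as a scalar, its value at $s = k + 1/2$, so that the form is the
square of this value.\<close>

lemma moment_form_symmetric_nonneg:
  assumes "finite V" "card V = 2 * k + 1"
    and sym: "\<And>A B. A \<subseteq> V \<Longrightarrow> B \<subseteq> V \<Longrightarrow> card A = card B \<Longrightarrow> p A = p B"
  shows "0 \<le> moment_form k V p p"
proof -
  obtain \<gamma> where \<gamma>: "p A = \<gamma> (card A)" if "A \<subseteq> V" for A
  proof -
    have "\<exists>\<gamma>. \<forall>A. A \<subseteq> V \<longrightarrow> p A = \<gamma> (card A)"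
      by (rule exI[of _ "\<lambda>i. p (SOME A. A \<subseteq> V \<and> card A = i)"])
         (metis (mono_tags, lifting) sym someI_ex)
    then show ?thesis using that by blast
  qed
  let ?r = "real k + 1/2"
  define E where "E = (\<Sum>i\<le>k. \<gamma> i * (?r gchoose i))"
  have group: "(\<Sum>A\<in>small_subsets k V. h A) = (\<Sum>i\<le>k. \<Sum>A | A \<subseteq> V \<and> card A = i. h A)" for h :: "nat set \<Rightarrow> real"
  proof -
    have "(\<Sum>i\<in>{..k}. \<Sum>A\<in>{A\<in>small_subsets k V. card A = i}. h A) = (\<Sum>A\<in>small_subsets k V. h A)"
      using assms by (intro sum.group finite_small_subsets) (auto simp: small_subsets_def)
    moreover have "{A\<in>small_subsets k V. card A = i} = {A. A \<subseteq> V \<and> card A = i}" if "i \<in> {..k}" for i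
      using that by (auto simp: small_subsets_def)
    ultimately show ?thesis by simp
  qed
  have inner: "(\<Sum>A\<in>small_subsets k V. p A * moment k (card (A \<union> B))) = E * moment k (card B)" if "B \<in> small_subsets k V" for B
  proof -
    have "(\<Sum>A\<in>small_subsets k V. p A * moment k (card (A \<union> B))) = (\<Sum>i\<le>k. \<gamma> i * (\<Sum>A | A \<subseteq> V \<and> card A = i. moment k (card (A \<union> B))))"
      unfolding group sum_distrib_left by (intro sum.cong refl) (auto simp: \<gamma>)
    also have "\<dots> = (\<Sum>i\<le>k. \<gamma> i * ((?r gchoose i) * moment k (card B)))"
    proof (intro sum.cong refl)
      fix i assume "i \<in> {..k}"
      then show "\<gamma> i * (\<Sum>A | A \<subseteq> V \<and> card A = i. moment k (card (A \<union> B))) = \<gamma> i * ((?r gchoose i) * moment k (card B))"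
        using that by (subst sum_moment_Un_card[OF assms(1,2)]) (auto simp: small_subsets_def)
    qed
    also have "\<dots> = E * moment k (card B)" by (simp add: E_def sum_distrib_right mult.assoc)
    finally show ?thesis .
  qed
  have "moment_form k V p p = (\<Sum>B\<in>small_subsets k V. p B * (\<Sum>A\<in>small_subsets k V. p A * moment k (card (A \<union> B))))"
    unfolding moment_form_def sum_distrib_left by (subst sum.swap) (simp add: mult_ac)
  also have "\<dots> = E * (\<Sum>B\<in>small_subsets k V. p B * moment k (card (B \<union> {})))"
    by (simp add: inner sum_distrib_left mult_ac)
  also have "\<dots> = E * E" by (subst inner) (auto simp: small_subsets_def)
  finally show ?thesis by simp
qed

theorem moment_form_nonneg:
  assumes "finite V" "card V = 2 * k + 1"
  shows "0 \<le> moment_form k V c c"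
  using assms
proof (induction k arbitrary: V c)
  case 0
  have "small_subsets 0 V = {{}}" using finite_subset[OF _ 0(1)] by (auto simp: small_subsets_def card_eq_0_iff)
  then show ?case by (simp add: moment_form_def)
next
  case (Suc k)
  have anti: "0 \<le> moment_form (Suc k) V e e"
    if "a \<in> V" "b \<in> V" "a \<noteq> b" "\<And>A. e (transpose a b ` A) = - e A" for a b e
    unfolding moment_form_antisymmetric[OF Suc.prems(1) that(1-3), where e = e, OF that(4)]
    using that Suc.prems by (intro mult_nonneg_nonneg Suc.IH) (auto simp: card_Diff_subset)
  obtain p where p: "\<forall>a\<in>V. \<forall>b\<in>V. act a b p = p" "moment_form (Suc k) V p p \<le> moment_form (Suc k) V c c"
    using moment_form_symmetrise[of V V "Suc k" c] Suc.prems anti by blast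
  have "0 \<le> moment_form (Suc k) V p p"
    using Suc.prems p(1) symmetric_eq_of_card_eq[OF Suc.prems(1)] by (intro moment_form_symmetric_nonneg) blast+
  with p(2) show ?case by simp
qed

section \<open>A pseudo-expectation with half-integral sum of variables\<close>

text \<open>Variables outside $V$ are set to 0, so that the functional also serves polynomials in more
than $2k+1$ variables.\<close>

definition pseudo_expectation :: "nat \<Rightarrow> nat set \<Rightarrow> mpoly \<Rightarrow> real" where
  "pseudo_expectation k V = lin_ext (\<lambda>m. if Poly_Mapping.keys m \<subseteq> V then moment k (card (Poly_Mapping.keys m)) else 0)"

text \<open>Collecting the coefficients of $q$ by the supports of the monomials turns the value at $q^2$
into the moment form.\<close>

lemma pseudo_expectation_power2_nonneg:
  assumes V: "finite V" "card V = 2 * k + 1" and q: "total_degree q \<le> k"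
  shows "0 \<le> pseudo_expectation k V (q ^ 2)"
proof -
  let ?K = "Poly_Mapping.keys q"
  let ?M = "{m\<in>?K. Poly_Mapping.keys m \<subseteq> V}"
  define c where "c = (\<lambda>A. \<Sum>m\<in>{m\<in>?M. Poly_Mapping.keys m = A}. Poly_Mapping.lookup q m)"
  have small: "Poly_Mapping.keys m \<in> small_subsets k V" if "m \<in> ?M" for m
  proof -
    have "card (Poly_Mapping.keys m) \<le> (\<Sum>i\<in>Poly_Mapping.keys m. Poly_Mapping.lookup m i)"
      using sum_mono[of "Poly_Mapping.keys m" "\<lambda>_. 1::nat" "Poly_Mapping.lookup m"]
      by (auto simp: in_keys_iff Suc_le_eq)
    also have "\<dots> \<le> k" using q that by (auto simp: total_degree_le_iff monom_degree_def)
    finally show ?thesis using that by (simp add: small_subsets_def)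
  qed
  have group: "(\<Sum>A\<in>small_subsets k V. c A * h A) = (\<Sum>m\<in>?M. Poly_Mapping.lookup q m * h (Poly_Mapping.keys m))" for h
  proof -
    have "(\<Sum>A\<in>small_subsets k V. c A * h A) = (\<Sum>A\<in>small_subsets k V. \<Sum>m\<in>{m\<in>?M. Poly_Mapping.keys m = A}. Poly_Mapping.lookup q m * h (Poly_Mapping.keys m))"
      unfolding c_def sum_distrib_right by (intro sum.cong refl) auto
    also have "\<dots> = (\<Sum>m\<in>?M. Poly_Mapping.lookup q m * h (Poly_Mapping.keys m))"
      using small by (intro sum.group finite_small_subsets[OF V(1)]) auto
    finally show ?thesis .
  qed
  have "pseudo_expectation k V (q ^ 2) = (\<Sum>a\<in>?K. \<Sum>b\<in>?K. Poly_Mapping.lookup q a * Poly_Mapping.lookup q b *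
      (if Poly_Mapping.keys a \<subseteq> V \<and> Poly_Mapping.keys b \<subseteq> V then moment k (card (Poly_Mapping.keys a \<union> Poly_Mapping.keys b)) else 0))"
    unfolding pseudo_expectation_def power2_eq_square lin_ext_mult keys_plus_monom by simp
  also have "\<dots> = (\<Sum>a\<in>?M. \<Sum>b\<in>?M. Poly_Mapping.lookup q a * Poly_Mapping.lookup q b * moment k (card (Poly_Mapping.keys a \<union> Poly_Mapping.keys b)))"
    by (intro sum.mono_neutral_cong_right ballI sum.neutral) auto
  also have "\<dots> = (\<Sum>a\<in>?M. Poly_Mapping.lookup q a * (\<Sum>B\<in>small_subsets k V. c B * moment k (card (Poly_Mapping.keys a \<union> B))))"
    unfolding group by (simp add: sum_distrib_left mult.assoc)
  also have "\<dots> = (\<Sum>A\<in>small_subsets k V. c A * (\<Sum>B\<in>small_subsets k V. c B * moment k (card (A \<union> B))))"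
    by (rule group[symmetric])
  also have "\<dots> = moment_form k V c c" by (simp add: moment_form_def sum_distrib_left mult.assoc)
  finally show ?thesis using moment_form_nonneg[OF V] by simp
qed

lemma pseudo_expectation_I2: "p \<in> I2 U \<Longrightarrow> pseudo_expectation k V p = 0"
  unfolding pseudo_expectation_def by (rule lin_ext_keys_I2[where H = "\<lambda>A. if A \<subseteq> V then moment k (card A) else 0"])

definition consecutive_product :: "nat \<Rightarrow> nat set \<Rightarrow> mpoly" where
  "consecutive_product k U = ((\<Sum>i\<in>U. X i) - Const (real k)) * ((\<Sum>i\<in>U. X i) - Const (real k + 1))"

lemma Const_add: "Const a + Const b = Const (a + b)"
  and Const_mult: "Const a * Const b = Const (a * b)"
  by (simp_all add: Const_def single_add mult_single)

text \<open>Formally this is $(s-k)(s-k-1)$ at $s = k + 1/2$. For $k = 0$ there is only one variable, the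
moment of order 2 never occurs, and the value would be 0.\<close>

lemma pseudo_expectation_consecutive_product:
  assumes "finite U" "V \<subseteq> U" "card V = 2 * k + 1" "k > 0"
  shows "pseudo_expectation k V (consecutive_product k U) = - 1/4"
proof -
  have fV: "finite V" using assms finite_subset by blast
  have moment1: "moment k 1 = 1/2" by (simp add: moment_def field_simps)
  have moment2: "2 * real k * moment k 2 = real k / 2 - 1/4"
    using moment_Suc[of k 1] moment1 assms(4) by (simp add: numeral_2_eq_2 field_simps)
  have XX: "pseudo_expectation k V (X i * X j) = (if i \<in> V \<and> j \<in> V then if i = j then 1/2 else moment k 2 else 0)" for i j
    unfolding pseudo_expectation_def X_def using moment1 by (auto simp: mult_single keys_plus_monom numeral_2_eq_2)
  have X: "pseudo_expectation k V (X i) = (if i \<in> V then 1/2 else 0)" for i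
    unfolding pseudo_expectation_def X_def using moment1 by simp
  have C: "pseudo_expectation k V (Const c) = c" for c by (simp add: pseudo_expectation_def Const_def)
  have CX: "pseudo_expectation k V (Const c * X i) = c * pseudo_expectation k V (X i)" for c i
    by (simp add: pseudo_expectation_def Const_def X_def mult_single)
  have linear: "pseudo_expectation k V (p + q) = pseudo_expectation k V p + pseudo_expectation k V q" "pseudo_expectation k V (p - q) = pseudo_expectation k V p - pseudo_expectation k V q"
    "pseudo_expectation k V (\<Sum>i\<in>I. f i) = (\<Sum>i\<in>I. pseudo_expectation k V (f i))" for p q f and I :: "nat set"
    by (simp_all add: pseudo_expectation_def lin_ext_add lin_ext_diff lin_ext_sum)
  have restr: "(\<Sum>i\<in>U. if i \<in> V then g i else 0) = (\<Sum>i\<in>V. g i)" for g :: "nat \<Rightarrow> real"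
    using assms by (simp add: sum.inter_restrict[symmetric] Int_absorb1)
  have "(\<Sum>i\<in>U. \<Sum>j\<in>U. pseudo_expectation k V (X i * X j)) = (\<Sum>i\<in>U. if i \<in> V then (\<Sum>j\<in>U. if j \<in> V then if i = j then 1/2 else moment k 2 else 0) else 0)"
    unfolding XX by (intro sum.cong refl) auto
  also have "\<dots> = (\<Sum>i\<in>V. \<Sum>j\<in>V. if i = j then 1/2 else moment k 2)" unfolding restr ..
  also have "\<dots> = (\<Sum>i\<in>V. 1/2 + 2 * real k * moment k 2)"
  proof (intro sum.cong refl)
    fix i assume i: "i \<in> V"
    then have "(\<Sum>j\<in>V. if i = j then 1/2 else moment k 2) = 1/2 + (\<Sum>j\<in>V - {i}. moment k 2)"
      using fV by (subst sum.remove[of V i]) (auto intro!: sum.cong)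
    then show "(\<Sum>j\<in>V. if i = j then 1/2 else moment k 2) = 1/2 + 2 * real k * moment k 2"
      using i fV assms(3) by simp
  qed
  also have "\<dots> = (2 * real k + 1) * (real k / 2 + 1/4)"
    unfolding moment2 using assms(3) by (simp add: algebra_simps)
  finally have 2: "(\<Sum>i\<in>U. \<Sum>j\<in>U. pseudo_expectation k V (X i * X j)) = (2 * real k + 1) * (real k / 2 + 1/4)" .
  have 1: "(\<Sum>i\<in>U. pseudo_expectation k V (X i)) = (2 * real k + 1) / 2"
    unfolding X restr using assms(3) by simp
  then have scaled: "(\<Sum>i\<in>U. (2 * real k + 1) * pseudo_expectation k V (X i)) = (2 * real k + 1) * ((2 * real k + 1) / 2)"
    by (simp only: sum_distrib_left[symmetric])
  have "consecutive_product k U = (\<Sum>i\<in>U. \<Sum>j\<in>U. X i * X j) - (\<Sum>i\<in>U. Const (2 * real k + 1) * X i) + Const (real k * (real k + 1))"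
  proof -
    have "Const (real k) + Const (real k + 1) = Const (2 * real k + 1)"
      "Const (real k) * Const (real k + 1) = Const (real k * (real k + 1))"
      by (simp_all add: Const_add Const_mult)
    moreover have "consecutive_product k U = (\<Sum>i\<in>U. X i) * (\<Sum>i\<in>U. X i) -
        (Const (real k) + Const (real k + 1)) * (\<Sum>i\<in>U. X i) + Const (real k) * Const (real k + 1)"
      unfolding consecutive_product_def by (simp add: algebra_simps)
    ultimately show ?thesis by (simp only: sum_product[of X U X U] sum_distrib_left[of "Const (2 * real k + 1)" X U])
  qed
  then have "pseudo_expectation k V (consecutive_product k U) = (2 * real k + 1) * (real k / 2 + 1/4) - (2 * real k + 1) * ((2 * real k + 1) / 2) + real k * (real k + 1)"
    by (simp only: linear CX C 2 scaled)
  also have "\<dots> = - 1/4" by (simp add: field_simps)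
  finally show ?thesis .
qed

text \<open>For $k > 0$ the pseudo-expectation of a sum of squares of degree at most $k$ is nonnegative,
but that of $p$ is $-1/4$. For $k = 0$ such sums are constant on the cube, whereas $p$ vanishes at
the empty set and not at $U$.\<close>

lemma consecutive_product_not_sos:
  assumes "U \<subseteq> {1..n}" "card U \<ge> 2 * k + 1" "card U \<ge> 2" "p \<in> poly_ring U"
    and ev: "\<And>S. S \<subseteq> U \<Longrightarrow> eval_poly (indicator S) p = (real (card S) - real k) * (real (card S) - real k - 1)"
  shows "\<not> sos_mod U (I2 U) k p"
proof
  assume "sos_mod U (I2 U) k p"
  then obtain m q where q: "\<forall>r\<in>{1..m}. total_degree (q r) \<le> k" "p - (\<Sum>r = 1..m::nat. q r ^ 2) \<in> I2 U"
    unfolding sos_mod_def by blast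
  show False
  proof (cases "k = 0")
    case True
    have const: "eval_poly (indicator S) (q r) = eval_poly (indicator {}) (q r)" if "r \<in> {1..m}" for r S
    proof -
      have no_vars: "Poly_Mapping.keys a = {}" if "a \<in> Poly_Mapping.keys (q r)" for a
      proof -
        have "total_degree (q r) \<le> 0" using q(1) \<open>r \<in> {1..m}\<close> True by auto
        then have "monom_degree a = 0" using that unfolding total_degree_le_iff by blast
        then show ?thesis unfolding monom_degree_def by (auto simp: in_keys_iff intro: poly_mapping_eqI)
      qed
      show ?thesis unfolding eval_indicator_eq_lin_ext lin_ext_def
        by (intro sum.cong refl) (simp only: no_vars empty_subsetI)
    qed
    have "eval_poly (indicator S) p = (\<Sum>r = 1..m. eval_poly (indicator {}) (q r) ^ 2)" for S
    proof -
      have "eval_poly (indicator S) p = (\<Sum>r = 1..m. eval_poly (indicator S) (q r) ^ 2)"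
        using ev_I2[OF q(2), of S] by (simp add: ev_simps)
      also have "\<dots> = (\<Sum>r = 1..m. eval_poly (indicator {}) (q r) ^ 2)"
        by (intro sum.cong refl arg_cong[of _ _ "\<lambda>x. x ^ 2"] const)
      finally show ?thesis .
    qed
    then have "eval_poly (indicator U) p = eval_poly (indicator {}) p" by metis
    then show False using ev[of U] ev[of "{}"] True assms(3) by simp
  next
    case False
  have fU: "finite U" using assms(1) finite_subset by blast
  obtain V where V: "V \<subseteq> U" "card V = 2 * k + 1" using assms(2) by (metis obtain_subset_with_card_n)
  have fV: "finite V" using V fU finite_subset by blast
  have "consecutive_product k U \<in> poly_ring U"
    unfolding consecutive_product_def
    by (intro poly_ring_mult poly_ring_diff poly_ring_sum) (auto intro: polys_in_ring[OF polys_X] polys_in_ring[OF polys_Const])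
  then have "p - consecutive_product k U \<in> I2 U"
  proof (intro in_I2_if_vanishing_on_cube[OF assms(1)] poly_ring_diff assms(4))
    fix S assume S: "S \<subseteq> U"
    have "(\<Sum>i\<in>U. indicator S i) = real (card S)"
      using S fU by (simp add: indicator_def sum.If_cases Int_absorb1)
    then show "eval_poly (indicator S) (p - consecutive_product k U) = 0"
      using ev[OF S] by (simp add: consecutive_product_def ev_simps algebra_simps)
  qed
  then have "pseudo_expectation k V p = pseudo_expectation k V (consecutive_product k U)"
    using pseudo_expectation_I2 by (fastforce simp: pseudo_expectation_def lin_ext_diff)
  also have "\<dots> = - 1/4" using fU V False by (intro pseudo_expectation_consecutive_product) auto
  finally have "pseudo_expectation k V p = - 1/4" .
  moreover have "pseudo_expectation k V p = (\<Sum>r = 1..m. pseudo_expectation k V (q r ^ 2))"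
    using pseudo_expectation_I2[OF q(2), of k V] by (simp add: pseudo_expectation_def lin_ext_diff lin_ext_sum)
  moreover have "0 \<le> (\<Sum>r = 1..m. pseudo_expectation k V (q r ^ 2))"
    using q(1) by (intro sum_nonneg pseudo_expectation_power2_nonneg fV V) auto
  ultimately show False by simp
  qed
qed

section \<open>From local to global submodularity\<close>

text \<open>The second differences being nonpositive, the marginal value of an element decreases when the
set grows one element at a time; adding the elements of $S - T$ in turn to $S \cap T$ and to $T$
then compares the total gains.\<close>

lemma submodular_if_local:
  assumes local: "\<And>i j S. i \<in> {1..n} \<Longrightarrow> j \<in> {1..n} \<Longrightarrow> i \<noteq> j \<Longrightarrow> S \<subseteq> {1..n} - {i, j} \<Longrightarrow>
    f (insert i (insert j S)) + f S \<le> f (insert i S) + f (insert j S)"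
  shows "submodular n f"
proof -
  have marginal: "f (insert x (A \<union> C)) - f (A \<union> C) \<le> f (insert x A) - f A"
    if "finite C" "A \<subseteq> {1..n}" "C \<subseteq> {1..n}" "x \<in> {1..n}" "x \<notin> A \<union> C" for A C x
    using that
  proof (induction C rule: finite_induct)
    case (insert y C)
    show ?case
    proof (cases "y \<in> A")
      case True
      then show ?thesis using insert by (simp add: insert_absorb)
    next
      case False
      have "f (insert x (insert y (A \<union> C))) + f (A \<union> C) \<le> f (insert x (A \<union> C)) + f (insert y (A \<union> C))"
        using insert False by (intro local) auto
      then show ?thesis using insert by simp
    qed
  qed simp
  have grow: "f (T \<union> C) - f T \<le> f (S \<inter> T \<union> C) - f (S \<inter> T)"
    if "finite C" "C \<subseteq> S - T" "S \<subseteq> {1..n}" "T \<subseteq> {1..n}" for S T C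
    using that
  proof (induction C rule: finite_induct)
    case (insert y C)
    have T: "S \<inter> T \<union> C \<union> T = T \<union> C" by blast
    have "f (insert y (S \<inter> T \<union> C \<union> T)) - f (S \<inter> T \<union> C \<union> T) \<le> f (insert y (S \<inter> T \<union> C)) - f (S \<inter> T \<union> C)"
      using insert finite_subset[OF insert.prems(3)] by (intro marginal) auto
    then show ?case using insert unfolding T by simp
  qed simp
  show ?thesis
    unfolding submodular_def
  proof (intro allI impI)
    fix S T assume ST: "S \<subseteq> {1..n}" "T \<subseteq> {1..n}"
    have "T \<union> (S - T) = S \<union> T" "S \<inter> T \<union> (S - T) = S" by auto
    then show "f S + f T \<ge> f (S \<union> T) + f (S \<inter> T)"
      using grow[of "S - T" S T] ST finite_subset[OF ST(1)] by simp
  qed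
qed

lemma mle_in_ml_ring: "mle n f \<in> ml_ring {1..n}"
  using is_mle_mle[of n f] by (simp add: is_mle_def ml_ring_def)

theorem sos_submodular_imp_submodular:
  assumes "sos_submodular n t f"
  shows "submodular n f"
proof (rule submodular_if_local)
  fix i j S assume ij: "i \<in> {1..n}" "j \<in> {1..n}" "i \<noteq> j" and S: "S \<subseteq> {1..n} - {i, j}"
  have ev: "eval_poly (indicator A) (mle n f) = f A" if "A \<subseteq> {1..n}" for A
    using is_mle_mle[of n f] that by (simp add: is_mle_def)
  have "0 \<le> eval_poly (indicator S) (- partial_deriv i (partial_deriv j (mle n f)))"
    using assms ij by (intro sos_mod_nonneg[of "{1..n} - {i, j}" t]) (simp only: sos_submodular_def, blast)
  moreover have "i \<notin> S" "j \<notin> S" using S by auto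
  ultimately show "f (insert i (insert j S)) + f S \<le> f (insert i S) + f (insert j S)"
    using S ij ev_second_partial_deriv[OF mle_in_ml_ring ij(3), of S n f]
    by (simp add: ev_minus) (simp add: ev subset_Diff_insert subset_insertI2 insert_subset)
qed

section \<open>The extremal family\<close>

text \<open>With $n = 2k+3$ or $n = 2k+4$ the constants of the odd and of the even family become the same
functions of $k$.\<close>

definition F_family :: "nat \<Rightarrow> nat \<Rightarrow> mpoly" where
  "F_family n k = (- Const 2 * (\<Sum>(i, j)\<in>{(i, j). 1 \<le> i \<and> i < j \<and> j \<le> n - 2}. X i * X j)
      - Const (real k * (real k + 1))) * X (n - 1) * X n
    + Const (2 * real k) * (\<Sum>i = 1..n - 2. X i) * (X (n - 1) * X n - X (n - 1) - X n)"

lemma F_odd_eq: "F_odd (2 * k + 3) = F_family (2 * k + 3) k"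
proof -
  have "(real (2 * k + 3) ^ 2 - 4 * real (2 * k + 3) + 3) / 4 = real k * (real k + 1)"
    "real (2 * k + 3) - 3 = 2 * real k"
    by (simp_all add: power2_eq_square field_simps)
  then show ?thesis unfolding F_odd_def F_family_def by (simp only:)
qed

lemma F_even_eq: "F_even (2 * k + 4) = F_family (2 * k + 4) k"
proof -
  have "(real (2 * k + 4) - 2) * (real (2 * k + 4) - 4) / 4 = real k * (real k + 1)"
    "real (2 * k + 4) - 4 = 2 * real k"
    by (simp_all add: field_simps)
  then show ?thesis unfolding F_even_def F_family_def by (simp only:)
qed

lemma sum_pairs:
  fixes y :: "nat \<Rightarrow> real"
  assumes "\<And>i. y i ^ 2 = y i"
  shows "2 * (\<Sum>(i, j)\<in>{(i, j). 1 \<le> i \<and> i < j \<and> j \<le> N}. y i * y j) = (\<Sum>i = 1..N. y i) ^ 2 - (\<Sum>i = 1..N. y i)"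
proof (induction N)
  case 0
  have empty: "{(i, j). 1 \<le> i \<and> i < j \<and> j \<le> (0::nat)} = {}" by auto
  show ?case unfolding empty by simp
next
  case (Suc N)
  let ?P = "\<lambda>N. {(i, j). 1 \<le> i \<and> i < j \<and> j \<le> (N::nat)}"
  have fin: "finite (?P N)" by (rule finite_subset[of _ "{..N} \<times> {..N}"]) auto
  have P: "?P (Suc N) = ?P N \<union> (\<lambda>i. (i, Suc N)) ` {1..N}" by (auto simp: image_iff le_Suc_eq)
  have "(\<Sum>(i, j)\<in>?P (Suc N). y i * y j) = (\<Sum>(i, j)\<in>?P N. y i * y j) + (\<Sum>(i, j)\<in>(\<lambda>i. (i, Suc N)) ` {1..N}. y i * y j)"
    unfolding P using fin by (intro sum.union_disjoint) auto
  also have "(\<Sum>(i, j)\<in>(\<lambda>i. (i, Suc N)) ` {1..N}. y i * y j) = (\<Sum>i = 1..N. y i) * y (Suc N)"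
    by (subst sum.reindex) (auto simp: inj_on_def sum_distrib_right)
  finally show ?case using Suc assms[of "Suc N"] by (simp add: power2_sum algebra_simps)
qed

text \<open>The common family at a vertex with $s$ ones among the first $n-2$ coordinates and with last
coordinates $a, b$.\<close>

definition F_value :: "nat \<Rightarrow> real \<Rightarrow> real \<Rightarrow> real \<Rightarrow> real" where
  "F_value k s a b = - (s ^ 2 - s + real k * (real k + 1)) * a * b + 2 * real k * s * (a * b - a - b)"

lemma eval_F_family:
  "eval_poly (indicator S) (F_family n k) =
    F_value k (real (card (S \<inter> {1..n - 2}))) (indicator S (n - 1)) (indicator S n)"
proof -
  have sum: "(\<Sum>i = 1..n - 2. indicator S i) = real (card (S \<inter> {1..n - 2}))"
    by (simp add: indicator_def sum.If_cases Int_def conj_commute)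
  let ?s = "real (card (S \<inter> {1..n - 2}))" and ?a = "indicator S (n - 1) :: real" and ?b = "indicator S n :: real"
  have "2 * (\<Sum>(i, j)\<in>{(i, j). 1 \<le> i \<and> i < j \<and> j \<le> n - 2}. indicator S i * indicator S j) = ?s ^ 2 - ?s"
    unfolding sum[symmetric] by (rule sum_pairs) (simp add: indicator_def)
  then have pairs: "(\<Sum>(i, j)\<in>{(i, j). 1 \<le> i \<and> i < j \<and> j \<le> n - 2}. indicator S i * indicator S j) = (?s ^ 2 - ?s) / 2"
    by simp
  have "eval_poly (indicator S) (F_family n k) =
      (- 2 * (\<Sum>(i, j)\<in>{(i, j). 1 \<le> i \<and> i < j \<and> j \<le> n - 2}. indicator S i * indicator S j)
        - real k * (real k + 1)) * ?a * ?b + 2 * real k * ?s * (?a * ?b - ?a - ?b)"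
    unfolding F_family_def by (simp only: ev_simps split_def sum)
  also have "\<dots> = F_value k ?s ?a ?b"
    unfolding pairs F_value_def by (simp add: field_simps)
  finally show ?thesis .
qed

lemma F_family_in_ml_ring: "n \<ge> 4 \<Longrightarrow> F_family n k \<in> ml_ring {1..n}"
  unfolding F_family_def by (rule ml_ring_F_shape)

text \<open>All terms but $-2 x_i x_j x_{n-1} x_n$ have degree at most 3, and the monomial of $i = 1$,
$j = 2$ shows that no cancellation occurs.\<close>

lemma total_degree_F_family:
  assumes "n \<ge> 4"
  shows "total_degree (F_family n k) = 4"
proof (rule antisym)
  let ?P = "{(i, j). 1 \<le> i \<and> i < j \<and> j \<le> n - 2}"
  let ?e = "\<lambda>i. Poly_Mapping.single i (1::nat)"
  let ?m = "\<lambda>i j. ?e i + ?e j + ?e (n - 1) + ?e n"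
  define E :: mpoly where "E = (\<Sum>(i, j)\<in>?P. X i * X j)"
  define R where "R = Const (2 * real k) * (\<Sum>i = 1..n - 2. X i) * (X (n - 1) * X n - X (n - 1) - X n)
    - Const (real k * (real k + 1)) * (X (n - 1) * X n)"
  have eq: "F_family n k = R - Const 2 * (E * (X (n - 1) * X n))"
    unfolding F_family_def R_def E_def[symmetric] by (simp add: algebra_simps)
  have x: "X i \<in> polys UNIV 1" for i by (simp add: polys_X)
  have xx: "X i * X j \<in> polys UNIV 2" for i j using polys_mult[OF x x, of i j] unfolding one_add_one .
  have three: "0 + 1 + 2 = (3::nat)" "1 + 2 = (3::nat)" and four: "0 + (2 + 2) = (4::nat)" by simp_all
  have R: "R \<in> polys UNIV 3"
  proof -
    have "Const (2 * real k) * (\<Sum>i = 1..n - 2. X i) \<in> polys UNIV (0 + 1)"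
      by (intro polys_mult polys_Const polys_sum x)
    moreover have "X (n - 1) * X n - X (n - 1) - X n \<in> polys UNIV 2"
      using polys_mono[OF x, of 2] by (intro polys_diff xx) auto
    ultimately have "Const (2 * real k) * (\<Sum>i = 1..n - 2. X i) * (X (n - 1) * X n - X (n - 1) - X n) \<in> polys UNIV (0 + 1 + 2)"
      by (rule polys_mult)
    moreover have "Const (real k * (real k + 1)) * (X (n - 1) * X n) \<in> polys UNIV (1 + 2)"
      by (intro polys_mult polys_Const xx)
    ultimately show ?thesis unfolding R_def three by (rule polys_diff)
  qed
  have E: "E \<in> polys UNIV 2" unfolding E_def by (intro polys_sum) (auto intro: xx)
  have "Const 2 * (E * (X (n - 1) * X n)) \<in> polys UNIV (0 + (2 + 2))"
    by (intro polys_mult polys_Const xx E)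
  then have "F_family n k \<in> polys UNIV 4"
    unfolding eq four using polys_mono[OF R, of 4] by (intro polys_diff) auto
  then show "total_degree (F_family n k) \<le> 4" by (simp add: polys_def)
  have deg: "monom_degree (?e i) = 1" for i by (simp add: monom_degree_def)
  have degm: "monom_degree (?m 1 2) = 4" by (simp only: monom_degree_add deg)
  have "?m 1 2 \<notin> Poly_Mapping.keys R"
  proof
    assume "?m 1 2 \<in> Poly_Mapping.keys R"
    then have "monom_degree (?m 1 2) \<le> 3" using R unfolding polys_iff by blast
    then show False unfolding degm by simp
  qed
  then have "Poly_Mapping.lookup R (?m 1 2) = 0" by (simp only: not_in_keys_iff_lookup_eq_zero)
  moreover have "Const 2 * (E * (X (n - 1) * X n)) = (\<Sum>(i, j)\<in>?P. Poly_Mapping.single (?m i j) 2)"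
  proof -
    have quartic: "Const 2 * (X i * X j * (X a * X b)) = Poly_Mapping.single (?e i + ?e j + ?e a + ?e b) 2" for i j a b
      unfolding Const_def X_def mult_single by (simp add: add.assoc)
    show ?thesis unfolding E_def by (simp only: sum_distrib_left sum_distrib_right split_def quartic)
  qed
  moreover have "0 < Poly_Mapping.lookup (\<Sum>(i, j)\<in>?P. Poly_Mapping.single (?m i j) (2::real)) (?m 1 2)"
    unfolding lookup_sum
  proof (rule sum_pos2)
    show "finite ?P" by (rule finite_subset[of _ "{..n} \<times> {..n}"]) auto
    show "(1, 2) \<in> ?P" using assms by auto
  qed (auto simp: lookup_single when_def)
  ultimately have "?m 1 2 \<in> Poly_Mapping.keys (F_family n k)"
    unfolding eq by (simp add: in_keys_iff lookup_minus)
  then have "monom_degree (?m 1 2) \<le> total_degree (F_family n k)"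
    using total_degree_le_iff by blast
  then show "4 \<le> total_degree (F_family n k)" unfolding degm .
qed

lemma card_insert_Int:
  assumes "finite A" "i \<notin> S"
  shows "card (insert i S \<inter> A) = card (S \<inter> A) + of_bool (i \<in> A)"
  using assms by (auto simp: Int_insert_left)

lemma ev_second_F_family:
  assumes n: "n \<ge> 4" and ij: "i \<in> {1..n}" "j \<in> {1..n}" "i \<noteq> j" and S: "S \<subseteq> {1..n} - {i, j}"
  defines "s \<equiv> real (card (S \<inter> {1..n - 2}))"
  shows "eval_poly (indicator S) (- partial_deriv i (partial_deriv j (F_family n k))) =
    (if i \<le> n - 2 \<and> j \<le> n - 2 then 2 * indicator S (n - 1) * indicator S n
     else if i \<le> n - 2 \<or> j \<le> n - 2 then
       (let z = indicator S (if n \<in> {i, j} then n - 1 else n) in 2 * z * s + 2 * real k * (1 - z))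
     else (s - real k) * (s - real k - 1))"
proof -
  have notin: "i \<notin> S" "j \<notin> S" using S by auto
  have card: "real (card (insert i (insert j S) \<inter> {1..n - 2})) = s + of_bool (i \<le> n - 2) + of_bool (j \<le> n - 2)"
    "real (card (insert i S \<inter> {1..n - 2})) = s + of_bool (i \<le> n - 2)"
    "real (card (insert j S \<inter> {1..n - 2})) = s + of_bool (j \<le> n - 2)"
    using notin ij by (simp_all add: card_insert_Int s_def)
  have *: "eval_poly (indicator S) (- partial_deriv i (partial_deriv j (F_family n k))) =
     - (F_value k (s + of_bool (i \<le> n - 2) + of_bool (j \<le> n - 2)) (indicator (insert i (insert j S)) (n - 1)) (indicator (insert i (insert j S)) n)
       - F_value k (s + of_bool (i \<le> n - 2)) (indicator (insert i S) (n - 1)) (indicator (insert i S) n)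
       - F_value k (s + of_bool (j \<le> n - 2)) (indicator (insert j S) (n - 1)) (indicator (insert j S) n)
       + F_value k s (indicator S (n - 1)) (indicator S n))"
    unfolding ev_minus ev_second_partial_deriv[OF F_family_in_ml_ring[OF n] ij(3) notin] eval_F_family card
    by (simp add: s_def)
  obtain N where N: "n = N + 2" using n le_Suc_ex[of 2 n] by auto
  then have sub: "n - 1 = N + 1" "n - 2 = N" by simp_all
  have ind: "indicator (insert a A) b = (if a = b then 1 else indicator A b :: real)" for a b :: nat and A
    by (simp add: indicator_def)
  have out: "indicator S i = (0::real)" "indicator S j = (0::real)" using notin by simp_all
  consider (both) "i \<le> N" "j \<le> N"
    | (left1) "i \<le> N" "j = N + 1" | (left2) "i \<le> N" "j = N + 2"
    | (right1) "j \<le> N" "i = N + 1" | (right2) "j \<le> N" "i = N + 2"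
    | (none1) "i = N + 1" "j = N + 2" | (none2) "i = N + 2" "j = N + 1"
    using ij unfolding N by force
  then show ?thesis
    unfolding * unfolding sub unfolding N
    by cases (use out in \<open>simp_all add: ind F_value_def Let_def algebra_simps power2_eq_square\<close>)
qed

lemma sum_indicator_subset:
  assumes "finite A"
  shows "(\<Sum>i\<in>A. indicator S i) = real (card (S \<inter> A))"
  using assms by (simp add: indicator_def sum.If_cases Int_def conj_commute)

text \<open>Apart from the pair $(n-1, n)$, whose sum of squares is the hypothesis, the derivatives have
explicit sums of squares of degree at most 2, namely $2 (x_{n-1} x_n)^2$ and
$\sum_a 2 (z x_a)^2 + 2k (1-z)^2$.\<close>

lemma sos_submodular_F_family:
  assumes n: "n \<ge> 4" and t: "t \<ge> 2" and mle: "mle n f = F_family n k"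
    and w: "w \<in> sos {1..n - 2} t"
    and ev_w: "\<And>S. S \<subseteq> {1..n - 2} \<Longrightarrow> eval_poly (indicator S) w = (real (card S) - real k) * (real (card S) - real k - 1)"
  shows "sos_submodular n t f"
  unfolding sos_submodular_def mle
proof (intro ballI impI)
  fix i j assume ij: "i \<in> {1..n}" "j \<in> {1..n}" "i \<noteq> j"
  let ?V = "{1..n} - {i, j}"
  let ?p = "- partial_deriv i (partial_deriv j (F_family n k))"
  note ev = ev_second_F_family[OF n ij, of _ k]
  have xx: "X a * X b \<in> polys ?V t" if "a \<in> ?V" "b \<in> ?V" for a b
    using polys_mult[OF polys_X[OF that(1) order.refl] polys_X[OF that(2) order.refl]] t
    by (auto intro: polys_mono)
  have ring: "?p \<in> poly_ring ?V" by (rule second_partial_deriv_in_ring[OF F_family_in_ml_ring[OF n]])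
  consider "i \<le> n - 2" "j \<le> n - 2" | "(i \<le> n - 2) \<noteq> (j \<le> n - 2)" | "\<not> i \<le> n - 2" "\<not> j \<le> n - 2" by blast
  then have "\<exists>w\<in>sos ?V t. \<forall>S\<subseteq>?V. eval_poly (indicator S) ?p = eval_poly (indicator S) w"
  proof cases
    case 1
    have "n - 1 \<in> ?V" "n \<in> ?V" using 1 n by auto
    then have "Const 2 * (X (n - 1) * X n) ^ 2 \<in> sos ?V t"
      by (intro sos_scale sos_power2 xx) auto
    moreover have "eval_poly (indicator S) ?p = eval_poly (indicator S) (Const 2 * (X (n - 1) * X n) ^ 2)"
      if "S \<subseteq> ?V" for S
      using 1 unfolding ev[OF that] by (simp add: ev_simps indicator_def)
    ultimately show ?thesis by blast
  next
    case 2
    \<comment> \<open>the one of the last two variables that is not differentiated\<close>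
  define z where "z = (if n \<in> {i, j} then n - 1 else n)"
    let ?A = "{1..n - 2} - {i, j}"
    let ?w = "(\<Sum>a\<in>?A. Const 2 * (X z * X a) ^ 2) + Const (2 * real k) * (Const 1 - X z) ^ 2"
    have z: "z \<in> ?V" using 2 ij n by (auto simp: z_def)
    have "Const 1 - X z \<in> polys ?V t" using z t by (intro polys_diff polys_Const polys_X) auto
    then have "?w \<in> sos ?V t"
      using z by (intro sos_add sos_sum sos_scale sos_power2 xx) auto
    moreover have "eval_poly (indicator S) ?p = eval_poly (indicator S) ?w" if S: "S \<subseteq> ?V" for S
    proof -
      have SA: "S \<inter> ?A = S \<inter> {1..n - 2}" using S by auto
      have sq: "(indicator S a :: real) ^ 2 = indicator S a" "(1 - indicator S a :: real) ^ 2 = 1 - indicator S a" for a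
        by (simp_all add: indicator_def)
      have "eval_poly (indicator S) ?w = 2 * indicator S z * (\<Sum>a\<in>?A. indicator S a) + 2 * real k * (1 - indicator S z)"
        unfolding ev_simps power_mult_distrib sq by (simp add: sum_distrib_left mult.assoc)
      also have "(\<Sum>a\<in>?A. indicator S a) = real (card (S \<inter> {1..n - 2}))"
        using sum_indicator_subset[of ?A S] unfolding SA by simp
      finally show ?thesis using 2 unfolding ev[OF S] by (simp add: z_def Let_def)
    qed
    ultimately show ?thesis by blast
  next
    case 3
    then have V: "?V = {1..n - 2}" using ij n by auto
    have "eval_poly (indicator S) ?p = eval_poly (indicator S) w" if S: "S \<subseteq> ?V" for S
    proof -
      have "S \<inter> {1..n - 2} = S" using S unfolding V by blast
      then show ?thesis using 3 ev_w[of S] S unfolding ev[OF S] unfolding V by simp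
    qed
    then show ?thesis using w unfolding V by blast
  qed
  then show "sos_mod ?V (I2 ?V) t ?p"
    using sos_modI[of ?V n ?p _ t] ring by blast
qed

lemma sos_mod_mono: "sos_mod V I s p \<Longrightarrow> s \<le> t \<Longrightarrow> sos_mod V I t p"
  unfolding sos_mod_def by (meson order_trans)

lemma not_sos_submodular_F_family:
  assumes n: "n \<ge> 4" "n \<ge> 2 * k + 3" and mle: "mle n f = F_family n k" and t: "t \<le> k"
  shows "\<not> sos_submodular n t f"
proof
  assume sos: "sos_submodular n t f"
  have V: "{1..n} - {n - 1, n} = {1..n - 2}" using n by auto
  let ?p = "- partial_deriv (n - 1) (partial_deriv n (F_family n k))"
  have ij: "n - 1 \<in> {1..n}" "n \<in> {1..n}" "n - 1 \<noteq> n" using n by auto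
  then have "sos_mod {1..n - 2} (I2 {1..n - 2}) t ?p"
    using sos unfolding sos_submodular_def mle V[symmetric] by blast
  then have "sos_mod {1..n - 2} (I2 {1..n - 2}) k ?p" using t by (rule sos_mod_mono)
  moreover have "\<not> sos_mod {1..n - 2} (I2 {1..n - 2}) k ?p"
  proof (rule consecutive_product_not_sos[of _ n])
    show "?p \<in> poly_ring {1..n - 2}"
      using second_partial_deriv_in_ring[OF F_family_in_ml_ring[OF n(1)]] unfolding V[symmetric] .
    fix S assume S: "S \<subseteq> {1..n - 2}"
    then have "S \<inter> {1..n - 2} = S" by blast
    moreover have "\<not> n - 1 \<le> n - 2" "\<not> n \<le> n - 2" using n by auto
    ultimately show "eval_poly (indicator S) ?p = (real (card S) - real k) * (real (card S) - real k - 1)"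
      using ev_second_F_family[OF n(1) ij, of S k] S unfolding V by simp
  qed (use n in auto)
  ultimately show False by blast
qed

theorem proposition10:
  fixes n :: nat and f :: "nat set \<Rightarrow> real"
  assumes "n \<ge> 4"
    and "mle n f = (if odd n then F_odd n else F_even n)"
  shows "setfun_degree n f = 4 \<and>
    submodular n f \<and>
    (odd n \<longrightarrow> sos_submodular n (nat \<lceil>(real n - 2) / 2\<rceil>) f) \<and>
    (even n \<longrightarrow> sos_submodular n (nat \<lceil>(real n - 1) / 2\<rceil>) f) \<and>
    (\<forall>t::nat. int t \<le> \<lceil>(real n - 2) / 2\<rceil> - 1 \<longrightarrow> \<not> sos_submodular n t f)"
proof (cases "odd n")
  case True
  define k where "k = (n - 3) div 2"
  have n: "n = 2 * k + 3" "k \<ge> 1" using True assms(1) unfolding k_def by presburger+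
  have mle: "mle n f = F_family n k" using assms(2) True F_odd_eq[of k] n(1) by simp
  have ceil: "\<lceil>(real n - 2) / 2\<rceil> = int k + 1" using n(1) by (intro ceiling_unique) auto
  have sum: "(\<Sum>i\<in>{1..n - 2}. eval_poly (indicator S) (X i)) = real (card S)" if "S \<subseteq> {1..n - 2}" for S
    using that by (simp add: ev_X sum_indicator_subset Int_absorb2)
  have "\<exists>w\<in>sos {1..n - 2} (k + 1). \<forall>S\<subseteq>{1..n - 2}. eval_poly (indicator S) w =
      ((\<Sum>i\<in>{1..n - 2}. eval_poly (indicator S) (X i)) - real k) * ((\<Sum>i\<in>{1..n - 2}. eval_poly (indicator S) (X i)) - real k - 1)"
    using n by (intro consecutive_product_sos polys_X) (auto simp: ev_X indicator_def)
  then obtain w where "w \<in> sos {1..n - 2} (k + 1)"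
    "\<And>S. S \<subseteq> {1..n - 2} \<Longrightarrow> eval_poly (indicator S) w = (real (card S) - real k) * (real (card S) - real k - 1)"
    using sum by auto
  then have "sos_submodular n (k + 1) f"
    using n assms(1) by (intro sos_submodular_F_family[OF _ _ mle]) auto
  moreover have "nat \<lceil>(real n - 2) / 2\<rceil> = k + 1" unfolding ceil by simp
  moreover have "\<not> sos_submodular n t f" if "int t \<le> \<lceil>(real n - 2) / 2\<rceil> - 1" for t
    using that n(1) assms(1) unfolding ceil by (intro not_sos_submodular_F_family[OF _ _ mle]) auto
  ultimately show ?thesis
    using True total_degree_F_family[OF assms(1)] mle by (auto simp: setfun_degree_def intro: sos_submodular_imp_submodular)
next
  case False
  define k where "k = (n - 4) div 2"
  have n: "n = 2 * k + 4" using False assms(1) unfolding k_def by presburger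
  have mle: "mle n f = F_family n k" using assms(2) False F_even_eq[of k] n by simp
  have ceil: "\<lceil>(real n - 2) / 2\<rceil> = int k + 1" "\<lceil>(real n - 1) / 2\<rceil> = int k + 2"
    using n by (auto intro!: ceiling_unique)
  \<comment> \<open>the extra variable with index 0 is constantly 1\<close>
  define Y where "Y = (\<lambda>i. if i = 0 then Const 1 else X i)"
  have sum: "(\<Sum>i\<in>{0..n - 2}. eval_poly (indicator S) (Y i)) = 1 + real (card S)" if "S \<subseteq> {1..n - 2}" for S
  proof -
    have "{0..n - 2} = insert 0 {1..n - 2}" by auto
    then have "(\<Sum>i\<in>{0..n - 2}. eval_poly (indicator S) (Y i)) = 1 + (\<Sum>i\<in>{1..n - 2}. indicator S i)"
      by (simp add: Y_def ev_simps)
    then show ?thesis using that by (simp add: sum_indicator_subset Int_absorb2)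
  qed
  have "\<exists>w\<in>sos {1..n - 2} (k + 1 + 1). \<forall>S\<subseteq>{1..n - 2}. eval_poly (indicator S) w =
      ((\<Sum>i\<in>{0..n - 2}. eval_poly (indicator S) (Y i)) - real (k + 1)) * ((\<Sum>i\<in>{0..n - 2}. eval_poly (indicator S) (Y i)) - real (k + 1) - 1)"
    using n by (intro consecutive_product_sos) (auto simp: Y_def ev_simps indicator_def intro: polys_X polys_Const)
  then obtain w where "w \<in> sos {1..n - 2} (k + 1 + 1)"
    "\<And>S. S \<subseteq> {1..n - 2} \<Longrightarrow> eval_poly (indicator S) w = (real (card S) - real k) * (real (card S) - real k - 1)"
    using sum by auto
  then have "sos_submodular n (k + 1 + 1) f"
    using assms(1) by (intro sos_submodular_F_family[OF _ _ mle]) auto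
  moreover have "nat \<lceil>(real n - 1) / 2\<rceil> = k + 1 + 1" unfolding ceil by simp
  moreover have "\<not> sos_submodular n t f" if "int t \<le> \<lceil>(real n - 2) / 2\<rceil> - 1" for t
    using that n(1) assms(1) unfolding ceil by (intro not_sos_submodular_F_family[OF _ _ mle]) auto
  ultimately show ?thesis
    using False total_degree_F_family[OF assms(1)] mle by (auto simp: setfun_degree_def intro: sos_submodular_imp_submodular)
qed

end
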